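(* Assume condition [S] on $\mu$, condition (Q) on $Q=f\mu$ and condition (A) on $A$. Let $u$ be a minimizer of $E_\mu(v)=\frac12\int_\Omega(A_\mu\nabla_\mu v,\nabla_\mu v)\,d\mu-\int_\Omega fv\,d\mu$ over $H^{1,2}_\mu$. Then the vector measure $F:=A_\mu\nabla_\mu u\,\mu\in\mathcal M(\Omega;\mathbb{R}^N)$ satisfies $\langle F,\nabla\psi\rangle=\int_\Omega f\psi\,d\mu$ for all $\psi\in C^1_c(\Omega)$, its divergence has finite total variation, and its normal trace vanishes: $[F,\nu]|_{\partial\Omega}=0$, i.e. $\langle\operatorname{div}F,\varphi\rangle+\langle F,\nabla\varphi\rangle=0$ for all $\varphi\in C^2(\overline\Omega)$.
   Context: Tangent space and Sobolev space. Let $\mu$ be a positive finite Radon measure on $\mathbb{R}^N$. Set $\mathcal N_\mu=\{v\in C_c^\infty(\mathbb{R}^N): v=0\text{ on }\operatorname{supp}\mu\}$ and, for $x\in\mathbb{R}^N$, $N_\mu(x)=\{w(x): w\in C_c^\infty(\mathbb{R}^N;\mathbb{R}^N),\ \exists v\in\mathcal N_\mu\text{ with } w=\nabla v\text{ on }\operatorname{supp}\mu\}$. The tangent space $T_\mu(x)$ is the orthogonal complement of $N_\mu(x)$ in $\mathbb{R}^N$, and $\Pi_\mu(x)$ denotes the orthogonal projection of $\mathbb{R}^N$ onto $T_\mu(x)$. For $u\in C_c^\infty(\mathbb{R}^N)$ the tangential gradient is $\nabla_\mu u(x)=\Pi_\mu(x)\nabla u(x)$. The space $H^{1,2}_\mu$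 is the completion of $C_c^\infty(\mathbb{R}^N)$ with respect to the norm $(\|u\|^2_{L^2(\mu)}+\|\nabla_\mu u\|^2_{L^2(\mu)})^{1/2}$; $\nabla_\mu$ extends continuously to $H^{1,2}_\mu$. Condition [S]: $\Omega\subset\mathbb{R}^N$ is a smooth bounded domain; $S=\operatorname{supp}\mu=\bigcup_{j=1}^J S_j\subset\overline\Omega$ is compact, where each $S_j$ is a compact $C^2$ manifold (possibly with boundary) of dimension $k_j<N$; $\mu=\sum_{j=1}^J\mu_j$ with $\mu_j=\mathcal H^{k_j}\llcorner S_j$; $\mu_j(S_i)=0$ for $i\ne j$; for each $i$ the boundary of $S_i$ is contained in $\partial\Omega\cup\bigcup_{j\neq i}\overline{S_j}$; the relative interior of each $S_i$ does not meet $\partial\Omega$. Condition (A): $A:\Omega\to\mathbb{R}^{N\times N}$ is $\mu$-measurable and $\mu$-essentially bounded, $A(x)$ is symmetric and non-negative, and there is $\lambda>0$ with $(A(x)\xi,\xi)\ge\lambda|\xi|^2$ for all $\xi\in T_\mu(x)$, for $\mu$-a.e. $x$. Set $A_\mu(x)=\Pi_\mu(x)A(x)\Pi_\mu(x)$. Condition (Q): $Q$ is a measure of finite total variation supported in $\Omega$ of the form $Q=f\mu$ with $f\in L^2(\mu)$. Normal trace (Chen–Frid): for a vector-valued Radon measure $F$ on $\Omega$ of finite total variation, its divergence is the distribution $\langle\operatorname{div}F,\psi\rangle=-\langle F,\nabla\psi\rangle$, $\psi\in C^1_c(\Omega)$; $\operatorname{div}F$ has finite total variation if $\sup\{\langle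 F,\nabla\psi\rangle:\psi\in C^1_c(\Omega),|\psi|\le1\}<\infty$, in which case $\operatorname{div}F$ is a finite measure on $\Omega$. The normal trace $[F,\nu]|_{\partial\Omega}$ is the continuous linear functional $\varphi\mapsto\langle\operatorname{div}F,\varphi\rangle+\langle F,\nabla\varphi\rangle$ on $C^2(\overline\Omega)$, $\nu$ being the outer unit normal to $\partial\Omega$. *)

theory Defs
  imports "HOL-Analysis.Analysis"
begin

fun Ck :: "nat \<Rightarrow> ('a::euclidean_space \<Rightarrow> 'b::real_normed_vector) \<Rightarrow> bool" where
  "Ck 0 f = continuous_on UNIV f"
| "Ck (Suc k) f = ((\<forall>x. f differentiable (at x)) \<and>
                   (\<forall>v. Ck k (\<lambda>x. frechet_derivative f (at x) v)))"

definition smooth :: "('a::euclidean_space \<Rightarrow> 'b::real_normed_vector) \<Rightarrow> bool" where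
  "smooth f \<longleftrightarrow> (\<forall>k. Ck k f)"

definition tsupport :: "('a::real_normed_vector \<Rightarrow> 'b::zero) \<Rightarrow> 'a set" where
  "tsupport f = closure {x. f x \<noteq> 0}"

definition Cc_inf :: "('a::euclidean_space \<Rightarrow> 'b::real_normed_vector) set" where
  "Cc_inf = {f. smooth f \<and> compact (tsupport f)}"

definition C1c :: "'a::euclidean_space set \<Rightarrow> ('a \<Rightarrow> real) set" where
  "C1c \<Omega> = {f. Ck 1 f \<and> compact (tsupport f) \<and> tsupport f \<subseteq> \<Omega>}"

definition grad :: "(real^'n \<Rightarrow> real) \<Rightarrow> real^'n \<Rightarrow> real^'n" where
  "grad u x = (\<chi> i. frechet_derivative u (at x) (axis i 1))"

definition smooth_bounded_domain :: "(real^'n) set \<Rightarrow> bool" where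
  "smooth_bounded_domain \<Omega> \<longleftrightarrow> open \<Omega> \<and> connected \<Omega> \<and> \<Omega> \<noteq> {} \<and> bounded \<Omega> \<and>
     (\<forall>x\<in>frontier \<Omega>. \<exists>r>0. \<exists>g. smooth g \<and> grad g x \<noteq> 0 \<and>
         \<Omega> \<inter> ball x r = {y\<in>ball x r. g y < 0})"

definition omega_k :: "nat \<Rightarrow> real" where
  "omega_k k = pi powr (real k / 2) / Gamma (real k / 2 + 1)"

definition hausdorff_delta :: "nat \<Rightarrow> real \<Rightarrow> 'a::metric_space set \<Rightarrow> ennreal" where
  "hausdorff_delta k \<delta> E =
     (INF C \<in> {C :: nat \<Rightarrow> 'a set. E \<subseteq> (\<Union>i. C i) \<and>
                 (\<forall>i. bounded (C i) \<and> diameter (C i) \<le> \<delta>)}.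
        (\<Sum>i. (if C i = {} then 0 else ennreal (omega_k k * (diameter (C i) / 2) ^ k))))"

definition hausdorff :: "nat \<Rightarrow> 'a::metric_space set \<Rightarrow> ennreal" where
  "hausdorff k E = (SUP \<delta> \<in> {0<..}. hausdorff_delta k \<delta> E)"

definition hausdorff_restr :: "nat \<Rightarrow> 'a::metric_space set \<Rightarrow> 'a measure" where
  "hausdorff_restr k S = measure_of UNIV (sets borel) (\<lambda>A. hausdorff k (A \<inter> S))"

definition coord_space :: "'n set \<Rightarrow> (real^'n) set" where
  "coord_space B = {p. \<forall>i. i \<notin> B \<longrightarrow> p $ i = 0}"

definition half_coord_space :: "'n set \<Rightarrow> 'n \<Rightarrow> (real^'n) set" where
  "half_coord_space B b = {p \<in> coord_space B. p $ b \<ge> 0}"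

text \<open>A C^2 chart of dimension k of S around x: a C^2 map phi, an index set B of k coordinates,
a parameter domain V relatively open in R^k (the coordinate subspace of B) or in a half space
of it, and an open U containing x, such that phi is a homeomorphism of V onto S \<inter> U and an
immersion on V.  "interior" says whether V is open in R^k (True) or in a half space.\<close>
definition C2_chart :: "nat \<Rightarrow> (real^'n) set \<Rightarrow> real^'n \<Rightarrow> bool \<Rightarrow> bool" where
  "C2_chart k S x is_int \<longleftrightarrow>
     (\<exists>(B::'n set) (U::(real^'n) set) (V::(real^'n) set) (\<phi>::real^'n \<Rightarrow> real^'n). card B = k \<and> open U \<and> x \<in> U \<and> Ck 2 \<phi> \<and>
        (if is_int then openin (top_of_set (coord_space B)) V
         else (\<exists>b\<in>B. openin (top_of_set (half_coord_space B b)) V)) \<and>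
        (\<exists>\<psi>. homeomorphism V (S \<inter> U) \<phi> \<psi>) \<and>
        (\<forall>p\<in>V. inj_on (frechet_derivative \<phi> (at p)) (coord_space B)))"

definition C2_manifold :: "nat \<Rightarrow> (real^'n) set \<Rightarrow> bool" where
  "C2_manifold k S \<longleftrightarrow> compact S \<and>
     (\<forall>x\<in>S. C2_chart k S x True \<or> C2_chart k S x False)"

definition mbdry :: "nat \<Rightarrow> (real^'n) set \<Rightarrow> (real^'n) set" where
  "mbdry k S = {x\<in>S. \<not> C2_chart k S x True}"

definition minterior :: "nat \<Rightarrow> (real^'n) set \<Rightarrow> (real^'n) set" where
  "minterior k S = S - mbdry k S"

definition msupp :: "'a::metric_space measure \<Rightarrow> 'a set" where
  "msupp \<mu> = {x. \<forall>e>0. emeasure \<mu> (ball x e) > 0}"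

definition Nmu_fun :: "(real^'n) measure \<Rightarrow> (real^'n \<Rightarrow> real) set" where
  "Nmu_fun \<mu> = {v \<in> Cc_inf. \<forall>x\<in>msupp \<mu>. v x = 0}"

definition Nmu :: "(real^'n) measure \<Rightarrow> real^'n \<Rightarrow> (real^'n) set" where
  "Nmu \<mu> x = {w x | w. w \<in> Cc_inf \<and> (\<exists>v\<in>Nmu_fun \<mu>. \<forall>y\<in>msupp \<mu>. w y = grad v y)}"

definition Tmu :: "(real^'n) measure \<Rightarrow> real^'n \<Rightarrow> (real^'n) set" where
  "Tmu \<mu> x = {\<xi>. \<forall>\<eta>\<in>Nmu \<mu> x. \<xi> \<bullet> \<eta> = 0}"

definition Pimu :: "(real^'n) measure \<Rightarrow> real^'n \<Rightarrow> real^'n \<Rightarrow> real^'n" where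
  "Pimu \<mu> x \<xi> = (THE p. p \<in> Tmu \<mu> x \<and> (\<forall>t\<in>Tmu \<mu> x. (\<xi> - p) \<bullet> t = 0))"

definition grad_mu :: "(real^'n) measure \<Rightarrow> (real^'n \<Rightarrow> real) \<Rightarrow> real^'n \<Rightarrow> real^'n" where
  "grad_mu \<mu> u x = Pimu \<mu> x (grad u x)"

definition A_mu :: "(real^'n) measure \<Rightarrow> (real^'n \<Rightarrow> real^'n^'n) \<Rightarrow> real^'n \<Rightarrow> real^'n \<Rightarrow> real^'n" where
  "A_mu \<mu> A x \<xi> = Pimu \<mu> x (A x *v Pimu \<mu> x \<xi>)"

text \<open>The Sobolev space H^{1,2}_mu as the completion of C_c^infinity: its elements are
represented by the pairs (u, grad_mu u) in L^2(mu) x L^2(mu;R^N) that are limits of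
(v_n, grad_mu v_n) with v_n in C_c^infinity.  (Measures are taken in the completion of mu.)\<close>
definition H12 :: "(real^'n) measure \<Rightarrow> ((real^'n \<Rightarrow> real) \<times> (real^'n \<Rightarrow> real^'n)) set" where
  "H12 \<mu> = {(u, g). u \<in> borel_measurable (completion \<mu>) \<and> g \<in> borel_measurable (completion \<mu>) \<and>
      integrable (completion \<mu>) (\<lambda>x. (u x)\<^sup>2) \<and> integrable (completion \<mu>) (\<lambda>x. (norm (g x))\<^sup>2) \<and>
      (\<exists>v :: nat \<Rightarrow> real^'n \<Rightarrow> real. (\<forall>n. v n \<in> Cc_inf) \<and>
         ((\<lambda>n. \<integral>\<^sup>+ x. ennreal ((v n x - u x)\<^sup>2) \<partial>completion \<mu>) \<longlonglongrightarrow> 0) \<and>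
         ((\<lambda>n. \<integral>\<^sup>+ x. ennreal ((norm (grad_mu \<mu> (v n) x - g x))\<^sup>2) \<partial>completion \<mu>) \<longlonglongrightarrow> 0))}"

definition energy :: "(real^'n) measure \<Rightarrow> (real^'n) set \<Rightarrow> (real^'n \<Rightarrow> real^'n^'n) \<Rightarrow>
     (real^'n \<Rightarrow> real) \<Rightarrow> (real^'n \<Rightarrow> real) \<times> (real^'n \<Rightarrow> real^'n) \<Rightarrow> real" where
  "energy \<mu> \<Omega> A f vg =
     (1/2) * (\<integral>x\<in>\<Omega>. (A_mu \<mu> A x (snd vg x)) \<bullet> (snd vg x) \<partial>completion \<mu>)
     - (\<integral>x\<in>\<Omega>. f x * fst vg x \<partial>completion \<mu>)"

end

theory Submission
  imports Defs "HOL-Computational_Algebra.Polynomial"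
begin

text \<open>Perturbing the minimizer by \<open>t \<psi>\<close> with \<open>\<psi>\<close> smooth and compactly supported gives the Euler equation
  \<open>\<integral> A\<^sub>\<mu> \<nabla>\<^sub>\<mu> u \<bullet> \<nabla>\<psi> = \<integral> f \<psi>\<close> over \<open>\<Omega>\<close>; no boundary condition is imposed on \<open>\<psi>\<close>. Since \<open>\<mu>\<close> is finite,
  both sides are continuous under uniform convergence of \<open>\<psi>\<close> and \<open>\<nabla>\<psi>\<close> on \<open>\<Omega>\<close>, so mollification extends
  the equation to every \<open>C\<^sup>1\<close> function on the whole space. For test functions in \<open>C\<^sup>1\<^sub>c(\<Omega>)\<close> this identifies the divergence of
  \<open>F\<close> with \<open>- f \<mu>\<close>, and for \<open>C\<^sup>2\<close> functions up to the boundary it is the vanishing of the normal trace.\<close>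

subsection \<open>Smooth functions\<close>

text \<open>The vanishing trace is a natural boundary condition: \<open>H12\<close> is a closure of
  functions living on the whole space, so the admissible variations do not see the boundary of
  \<open>\<Omega>\<close>. Three facts have to hold before the variation makes sense.
  \<open>\<mu>\<close> must be finite. It is only given through Hausdorff measures, and finiteness
  comes from the charts: a compact \<open>C\<^sup>2\<close> manifold is covered by finitely many
  Lipschitz images of cubes of its own dimension. The projection \<open>Pimu \<mu> x\<close> must
  depend measurably on \<open>x\<close>. The spaces \<open>Tmu \<mu> x\<close> may change dimension
  from point to point, so continuity is out of reach; semicontinuity of the distance to
  \<open>Nmu \<mu> x\<close>, followed by polarisation, replaces it. The mollification must converge
  together with its gradient and also be smooth. These need the two forms of a convolution: with
  derivatives on the \<open>C\<^sup>1\<close> function the gradient is a mollified gradient, with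
  derivatives on the kernel all orders exist.\<close>

lemma Ck_SucI:
  assumes "\<And>x. (f has_derivative f' x) (at x)" and "\<And>v. Ck k (\<lambda>x. f' x v)"
  shows "Ck (Suc k) f"
proof -
  have "frechet_derivative f (at x) = f' x" for x
    using frechet_derivative_at[OF assms(1)[of x]] by simp
  with assms show ?thesis by (auto simp: differentiable_def)
qed

lemma Ck_has_derivative:
  "Ck (Suc k) f \<Longrightarrow> (f has_derivative frechet_derivative f (at x)) (at x)"
  by (simp add: frechet_derivative_works[symmetric])

lemma Ck_continuous:
  assumes "Ck k f"
  shows "continuous_on S f"
proof (cases k)
  case 0
  then show ?thesis using assms by (auto intro: continuous_on_subset)
next
  case (Suc m)
  then show ?thesis using assms
    by (auto intro!: continuous_at_imp_continuous_on differentiable_imp_continuous_within)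
qed

lemma Ck_Suc_imp_Ck: "Ck (Suc k) f \<Longrightarrow> Ck k f"
proof (induction k arbitrary: f)
  case 0
  then show ?case using Ck_continuous[of "Suc 0" f UNIV] by auto
next
  case (Suc k)
  then show ?case by simp
qed

lemma Ck_const: "Ck k (\<lambda>x. c)"
proof (induction k arbitrary: c)
  case (Suc k)
  then show ?case by (intro Ck_SucI[where f'="\<lambda>x v. 0"]) auto
qed auto

lemma Ck_add: "Ck k f \<Longrightarrow> Ck k g \<Longrightarrow> Ck k (\<lambda>x. f x + g x)"
proof (induction k arbitrary: f g)
  case 0
  then show ?case by (simp add: continuous_on_add)
next
  case (Suc k)
  then show ?case
    by (intro Ck_SucI[OF has_derivative_add[OF Ck_has_derivative Ck_has_derivative]]) auto
qed

lemma Ck_scaleR: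
  fixes f :: "'a::euclidean_space \<Rightarrow> real"
  shows "Ck k f \<Longrightarrow> Ck k g \<Longrightarrow> Ck k (\<lambda>x. f x *\<^sub>R g x)"
proof (induction k arbitrary: f g)
  case 0
  then show ?case by (simp add: continuous_on_scaleR)
next
  case (Suc k)
  \<comment> \<open>The product rule leaves one factor undifferentiated, so both functions are also
    needed at order \<open>k\<close>.\<close>
  note * = Suc.prems[THEN Ck_Suc_imp_Ck]
  show ?case
    using Suc *
    by (intro Ck_SucI[OF has_derivative_scaleR[OF Ck_has_derivative Ck_has_derivative]] Ck_add) auto
qed

lemma Ck_mult:
  fixes f g :: "'a::euclidean_space \<Rightarrow> real"
  shows "Ck k f \<Longrightarrow> Ck k g \<Longrightarrow> Ck k (\<lambda>x. f x * g x)"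
  using Ck_scaleR[of k f g] by simp

lemma Ck_bounded_linear:
  assumes "bounded_linear f"
  shows "Ck k f"
proof (cases k)
  case 0
  then show ?thesis using assms by (simp add: linear_continuous_on)
next
  case (Suc m)
  have "Ck (Suc m) f"
    by (rule Ck_SucI[OF bounded_linear.has_derivative[OF assms has_derivative_ident] Ck_const])
  then show ?thesis using Suc by simp
qed

lemma smooth_add: "smooth f \<Longrightarrow> smooth g \<Longrightarrow> smooth (\<lambda>x. f x + g x)"
  by (simp add: smooth_def Ck_add)

lemma smooth_scaleR_const: "smooth g \<Longrightarrow> smooth (\<lambda>x. c *\<^sub>R g x)"
  by (simp add: smooth_def Ck_scaleR Ck_const)

lemma smooth_frechet_derivative:
  "smooth f \<Longrightarrow> smooth (\<lambda>x. frechet_derivative f (at x) v)"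
  unfolding smooth_def using Ck.simps(2) by blast

text \<open>The family \<open>p(1/t) exp(-1/t)\<close> is closed under differentiation, also at \<open>t = 0\<close>.\<close>

definition flat_fun :: "real poly \<Rightarrow> real \<Rightarrow> real" where
  "flat_fun p t = (if t > 0 then poly p (1 / t) * exp (- (1 / t)) else 0)"

text \<open>Under \<open>s = 1 / t\<close> this is the decay of \<open>flat_fun p\<close> as
  \<open>t\<close> tends to 0 from the right.\<close>

lemma poly_exp_tendsto_0: "((\<lambda>s::real. poly p s * exp (- s)) \<longlongrightarrow> 0) at_top"
proof -
  have "((\<lambda>s. \<Sum>i\<le>degree p. coeff p i * (s ^ i / exp s)) \<longlongrightarrow> (\<Sum>i\<le>degree p. coeff p i * 0)) at_top"
    by (intro tendsto_sum tendsto_mult tendsto_const tendsto_power_div_exp_0)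
  then show ?thesis
    by (simp add: poly_altdef sum_distrib_right exp_minus divide_inverse mult.assoc)
qed

text \<open>With \<open>s = 1 / t\<close> one has ds/dt = -s^2, while the derivative of p(s) exp(-s)
  in s is (p' - p)(s) exp(-s). The new polynomial is therefore s^2 (p - p'), where
  \<open>[:0,0,1:]\<close> encodes s^2.\<close>

lemma flat_fun_has_derivative:
  "(flat_fun p has_real_derivative flat_fun ([:0,0,1:] * (p - pderiv p)) t) (at t)"
proof -
  consider "t > 0" | "t = 0" | "t < 0" by linarith
  then show ?thesis
  proof cases
    case 1
    have "((\<lambda>t. poly p (1 / t) * exp (- (1 / t))) has_real_derivative
        poly ([:0,0,1:] * (p - pderiv p)) (1 / t) * exp (- (1 / t))) (at t)"
      using 1
      by (auto intro!: derivative_eq_intros poly_DERIV[THEN DERIV_chain2] simp: field_simps power2_eq_square)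
    moreover have "\<forall>\<^sub>F s in nhds t. s > 0"
      using 1 eventually_nhds_in_open[of "{0<..}" t] by simp
    then have "\<forall>\<^sub>F s in nhds t. flat_fun p s = poly p (1 / s) * exp (- (1 / s))"
      by eventually_elim (simp add: flat_fun_def)
    ultimately show ?thesis
      using 1 DERIV_cong_ev[of t t "flat_fun p"] by (simp add: flat_fun_def)
  next
    case 2
    have r: "((\<lambda>y. flat_fun p y / y) \<longlongrightarrow> 0) (at_right 0)"
    proof -
      \<comment> \<open>Dividing by \<open>y\<close> multiplies the polynomial in
        \<open>1 / y\<close> by its variable \<open>[:0,1:]\<close>, so the difference quotient at 0
        is again a member of the family.\<close>
      have "((\<lambda>y. poly ([:0,1:] * p) (inverse y) * exp (- inverse y)) \<longlongrightarrow> 0) (at_right (0::real))"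
        by (rule filterlim_compose[OF poly_exp_tendsto_0 filterlim_inverse_at_top_right])
      moreover have "\<forall>\<^sub>F y in at_right (0::real). poly ([:0,1:] * p) (inverse y) * exp (- inverse y) = flat_fun p y / y"
        unfolding eventually_at_right_field
        by (rule exI[of _ 1]) (auto simp: flat_fun_def field_simps)
      ultimately show ?thesis by (rule Lim_transform_eventually)
    qed
    have l: "((\<lambda>y. flat_fun p y / y) \<longlongrightarrow> 0) (at_left 0)"
      by (rule tendsto_eventually)
        (auto simp: eventually_at_left_field flat_fun_def intro!: exI[of _ "-1"])
    from l r have "((\<lambda>y. flat_fun p y / y) \<longlongrightarrow> 0) (at 0)"
      by (simp add: filterlim_split_at)
    then show ?thesis
      using 2 by (simp add: has_field_derivative_iff flat_fun_def)
  next
    case 3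
    have "\<forall>\<^sub>F s in nhds t. s < 0"
      using 3 eventually_nhds_in_open[of "{..<0}" t] by simp
    then have "\<forall>\<^sub>F s in nhds t. flat_fun p s = 0"
      by eventually_elim (simp add: flat_fun_def)
    then show ?thesis
      using 3 DERIV_cong_ev[of t t "flat_fun p" "\<lambda>_. 0" 0] by (simp add: flat_fun_def)
  qed
qed

text \<open>This is exp(-1/(e - |x|^2)) on the ball of radius sqrt(e), and 0 elsewhere. The squared
  norm keeps the argument polynomial, hence smooth at the origin. The kernel is not normalised; its
  integral is divided out later.\<close>

definition bump :: "real \<Rightarrow> 'a::euclidean_space \<Rightarrow> real" where
  "bump e x = flat_fun 1 (e - x \<bullet> x)"

lemma smooth_bump: "smooth (bump e :: 'a::euclidean_space \<Rightarrow> real)"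
proof -
  \<comment> \<open>An induction for \<open>flat_fun 1\<close> alone does not close: each derivative
    brings a new polynomial, next to a factor linear in \<open>x\<close>. Hence the claim for every
    \<open>p\<close>.\<close>
  have "Ck k (\<lambda>x::'a. flat_fun p (e - x \<bullet> x))" for k p
  proof (induction k arbitrary: p)
    case 0
    have "isCont (flat_fun p) t" for t
      using flat_fun_has_derivative DERIV_isCont by blast
    then have "continuous_on UNIV (flat_fun p)"
      by (simp add: continuous_at_imp_continuous_on)
    moreover have "continuous_on UNIV (\<lambda>x::'a. e - x \<bullet> x)"
      by (intro continuous_intros)
    ultimately show ?case
      using continuous_on_compose2 by fastforce
  next
    case (Suc k)
    let ?q = "[:0,0,1:] * (p - pderiv p)"
    have "((\<lambda>x. flat_fun p (e - x \<bullet> x)) has_derivative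
        (\<lambda>v. flat_fun ?q (e - x \<bullet> x) * ((- 2) *\<^sub>R (x \<bullet> v)))) (at x)" for x :: 'a
      by (rule has_derivative_eq_rhs, rule DERIV_compose_FDERIV[OF flat_fun_has_derivative])
        (auto intro!: derivative_eq_intros simp: inner_commute algebra_simps)
    then show ?case
      by (rule Ck_SucI) (intro Ck_mult Suc.IH Ck_scaleR Ck_const Ck_bounded_linear bounded_linear_inner_left)
  qed
  then show ?thesis by (simp add: smooth_def bump_def[abs_def])
qed

lemma continuous_bump: "continuous_on S (bump e)"
  using smooth_bump Ck_continuous unfolding smooth_def by blast

lemma bump_nonneg: "0 \<le> bump e x"
  by (simp add: bump_def flat_fun_def)

lemma bump_eq_0: "x \<bullet> x \<ge> e \<Longrightarrow> bump e x = 0"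
  by (simp add: bump_def flat_fun_def)

lemma bump_0_pos: "e > 0 \<Longrightarrow> bump e 0 > 0"
  by (simp add: bump_def flat_fun_def)

subsection \<open>Mollification\<close>

text \<open>The derivative falls on \<open>F\<close>, whatever its role. It is used with
  \<open>F\<close> the function to be approximated, where only one derivative exists, and with
  \<open>F\<close> the kernel, where it can be iterated.\<close>

lemma convolution_has_derivative:
  fixes F \<rho> :: "'a::euclidean_space \<Rightarrow> real"
  assumes F: "Ck 1 F" and \<rho>: "continuous_on UNIV \<rho>"
  shows "((\<lambda>x. integral (cbox a b) (\<lambda>y. \<rho> y * F (x - y))) has_derivative
     (\<lambda>v. integral (cbox a b) (\<lambda>y. \<rho> y * frechet_derivative F (at (x - y)) v))) (at x)"
proof -
  let ?D = "\<lambda>x. frechet_derivative F (at x)"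
  have dF: "(F has_derivative ?D x) (at x)" for x
    using F Ck_has_derivative[of 0 F] by simp
  have bl: "bounded_linear (?D x)" for x
    using dF by (rule has_derivative_bounded_linear)
  \<comment> \<open>The Leibniz rule wants the derivative as a jointly continuous map into bounded
    linear functions, whereas \<open>Ck\<close> gives continuity one direction at a time. In finite
    dimension continuity in the basis directions suffices.\<close>
  define fx where "fx x y = Blinfun (\<lambda>v. \<rho> y * ?D (x - y) v)" for x y
  have fx: "blinfun_apply (fx x y) v = \<rho> y * ?D (x - y) v" for x y v
    unfolding fx_def
    by (subst bounded_linear_Blinfun_apply) (auto intro!: bounded_linear_const_mult bl)
  have contD: "continuous_on UNIV (\<lambda>x. ?D x v)" for v
    using F by simp
  have contF: "continuous_on S F" for S
    using Ck_continuous[OF F] .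
  have cont: "continuous_on S (\<lambda>p. fx (fst p) (snd p))" for S
  proof (rule continuous_on_blinfun_componentwise)
    fix i :: 'a
    have "continuous_on S (\<lambda>p. ?D (fst p - snd p) i)"
      by (rule continuous_on_compose2[OF contD]) (auto intro!: continuous_intros)
    moreover have "continuous_on S (\<lambda>p. \<rho> (snd p))"
      by (rule continuous_on_compose2[OF \<rho>]) (auto intro!: continuous_intros)
    ultimately show "continuous_on S (\<lambda>p. blinfun_apply (fx (fst p) (snd p)) i)"
      unfolding fx by (rule continuous_on_mult[rotated])
  qed
  have "((\<lambda>x. integral (cbox a b) (\<lambda>y. \<rho> y * F (x - y))) has_derivative
     integral (cbox a b) (fx x)) (at x within UNIV)"
  proof (rule leibniz_rule)
    show "((\<lambda>x. \<rho> t * F (x - t)) has_derivative blinfun_apply (fx x t)) (at x within UNIV)" for x t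
    proof -
      have "((\<lambda>x. F (x - t)) has_derivative ?D (x - t)) (at x)"
        by (rule has_derivative_compose[OF _ dF, of "\<lambda>x. x - t" "\<lambda>v. v"])
          (auto intro!: derivative_eq_intros)
      then have "((\<lambda>x. \<rho> t * F (x - t)) has_derivative (\<lambda>v. \<rho> t * ?D (x - t) v)) (at x)"
        by (rule has_derivative_mult_right)
      then show ?thesis
        by (simp add: fx[abs_def])
    qed
    show "(\<lambda>y. \<rho> y * F (x - y)) integrable_on cbox a b" for x
      by (intro integrable_continuous continuous_on_mult continuous_on_subset[OF \<rho>]
          continuous_on_compose2[OF contF[of UNIV]] continuous_intros) auto
    show "continuous_on (UNIV \<times> cbox a b) (\<lambda>(x, t). fx x t)"
      using cont by (simp add: case_prod_beta')
  qed auto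
  moreover have "(fx x) integrable_on cbox a b"
    by (rule integrable_continuous) (rule continuous_on_compose2[OF cont[of UNIV], of _ "\<lambda>y. (x, y)", simplified],
       intro continuous_intros)
  then have "blinfun_apply (integral (cbox a b) (fx x)) = (\<lambda>v. integral (cbox a b) (\<lambda>y. \<rho> y * ?D (x - y) v))"
    by (simp add: blinfun_apply_integral fx fun_eq_iff)
  ultimately show ?thesis by simp
qed

text \<open>Every directional derivative is a convolution of the same shape with \<open>F\<close>
  replaced by its own derivative, so the induction runs over all smooth \<open>F\<close>. Mere
  continuity of \<open>\<rho>\<close> is enough, which is what allows \<open>\<rho>\<close> to be
  the function being mollified.\<close>

lemma smooth_convolution:
  fixes F \<rho> :: "'a::euclidean_space \<Rightarrow> real"
  assumes \<rho>: "continuous_on UNIV \<rho>" and "smooth F"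
  shows "smooth (\<lambda>x. integral (cbox a b) (\<lambda>y. \<rho> y * F (x - y)))"
proof -
  have "Ck k (\<lambda>x. integral (cbox a b) (\<lambda>y. \<rho> y * F (x - y)))" for k
    using \<open>smooth F\<close>
  proof (induction k arbitrary: F)
    case 0
    then have "Ck 1 F" by (simp only: smooth_def)
    show ?case
      using convolution_has_derivative[OF \<open>Ck 1 F\<close> \<rho>]
      by (auto intro!: continuous_at_imp_continuous_on has_derivative_continuous)
  next
    case (Suc k)
    then have "Ck 1 F" by (simp only: smooth_def)
    show ?case
      by (rule Ck_SucI[OF convolution_has_derivative[OF \<open>Ck 1 F\<close> \<rho>]])
        (intro Suc.IH smooth_frechet_derivative Suc.prems)
  qed
  then show ?thesis by (simp add: smooth_def)
qed

text \<open>Bridge between the two integrals in use: differentiation under the integral is done over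
  a fixed box, change of variables for Lebesgue measure on the whole space.\<close>

lemma integral_cbox_eq_lborel:
  fixes h :: "'a::euclidean_space \<Rightarrow> real"
  assumes h: "continuous_on UNIV h" and 0: "\<And>y. y \<notin> cbox a b \<Longrightarrow> h y = 0"
  shows "integral (cbox a b) h = (\<integral>y. h y \<partial>lborel)"
proof -
  have "integrable lborel (\<lambda>x. indicator (cbox a b) x *\<^sub>R h x)"
    by (intro borel_integrable_compact) (auto intro: continuous_on_subset[OF h])
  then have "set_integrable lborel (cbox a b) h"
    by (simp add: set_integrable_def)
  then have "integral (cbox a b) h = (LINT x : cbox a b | lborel. h x)"
    by (simp add: set_borel_integral_eq_integral)
  also have "\<dots> = (\<integral>y. h y \<partial>lborel)"
    unfolding set_lebesgue_integral_def
    by (rule Bochner_Integration.integral_cong) (use 0 in \<open>auto simp: indicator_def\<close>)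
  finally show ?thesis .
qed

lemma lborel_distr_diff: "distr lborel borel (\<lambda>y. x - y) = (lborel :: 'a::euclidean_space measure)"
proof -
  show ?thesis
    using lborel_affine[of "-1" x] by (simp add: density_1)
qed

text \<open>The reflection y to x - y preserves Lebesgue measure and exchanges the factor that
  depends on \<open>x\<close>. Each of the two boxes contains the support of the factor evaluated at
  \<open>y\<close>, so no part of the integral is cut off.\<close>

lemma convolution_commute:
  fixes F \<rho> :: "'a::euclidean_space \<Rightarrow> real"
  assumes F: "continuous_on UNIV F" and \<rho>: "continuous_on UNIV \<rho>"
    and F0: "\<And>y. y \<notin> cbox a b \<Longrightarrow> F y = 0" and \<rho>0: "\<And>y. y \<notin> cbox c d \<Longrightarrow> \<rho> y = 0"
  shows "integral (cbox a b) (\<lambda>y. F y * \<rho> (x - y)) = integral (cbox c d) (\<lambda>y. \<rho> y * F (x - y))"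
proof -
  have cF: "continuous_on UNIV (\<lambda>y. F (x - y))" and c\<rho>: "continuous_on UNIV (\<lambda>y. \<rho> (x - y))"
    by (intro continuous_on_compose2[OF F] continuous_on_compose2[OF \<rho>] continuous_intros; simp)+
  have "integral (cbox a b) (\<lambda>y. F y * \<rho> (x - y)) = (\<integral>y. F y * \<rho> (x - y) \<partial>lborel)"
    by (rule integral_cbox_eq_lborel) (use F c\<rho> F0 in \<open>auto intro: continuous_on_mult\<close>)
  also have "\<dots> = (\<integral>y. F y * \<rho> (x - y) \<partial>distr lborel borel (\<lambda>y. x - y))"
    by (simp add: lborel_distr_diff)
  also have "\<dots> = (\<integral>y. \<rho> y * F (x - y) \<partial>lborel)"
  proof (subst integral_distr)
    show "(\<lambda>y. F y * \<rho> (x - y)) \<in> borel_measurable borel"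
      by (intro borel_measurable_continuous_onI continuous_on_mult F c\<rho>)
  qed (auto simp: mult.commute)
  also have "\<dots> = integral (cbox c d) (\<lambda>y. \<rho> y * F (x - y))"
    by (rule integral_cbox_eq_lborel[symmetric]) (use \<rho> cF \<rho>0 in \<open>auto intro: continuous_on_mult\<close>)
  finally show ?thesis .
qed

lemma bump_integral_pos:
  assumes "0 < e" and "e \<le> 1"
  shows "integral (cbox (-One) One) (bump e :: 'a::euclidean_space \<Rightarrow> real) > 0"
proof -
  let ?B = "cbox (-One) One :: 'a set"
  note c = continuous_bump[of ?B e]
  have i: "(bump e) integrable_on ?B"
    by (rule integrable_continuous[OF c])
  have "integral ?B (bump e) \<ge> 0"
    by (rule integral_nonneg[OF i]) (simp add: bump_nonneg)
  moreover have "integral ?B (bump e) \<noteq> 0"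
  proof
    assume "integral ?B (bump e) = 0"
    \<comment> \<open>A continuous nonnegative function with integral 0 over a nondegenerate box
      vanishes on it, contradicting positivity at the centre.\<close>
    then have "((bump e) has_integral 0) ?B"
      using i by (simp add: has_integral_iff)
    moreover have "(0::'a) \<in> ?B"
      by (auto simp: mem_box)
    moreover have "(One::'a) \<noteq> 0" by auto
    then have "box (-One) (One::'a) \<noteq> {}"
      by (simp add: box_ne_empty)
    ultimately have "bump e (0::'a) = 0"
      using has_integral_0_cbox_imp_0[OF c bump_nonneg] by blast
    then show False using bump_0_pos[OF assms(1), where 'a='a] by simp
  qed
  ultimately show ?thesis by simp
qed

lemma bump_eq_0_outside_box:
  assumes "e \<le> 1" and "y \<notin> cbox (-One) (One::'a::euclidean_space)"
  shows "bump e y = 0"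
proof -
  obtain i where i: "i \<in> Basis" "\<bar>y \<bullet> i\<bar> > 1"
    using assms(2) by (auto simp: mem_box abs_less_iff not_le)
  then have "norm y > 1" using Basis_le_norm[of i y] by linarith
  then have "y \<bullet> y \<ge> 1" by (simp add: dot_square_norm)
  with assms(1) show ?thesis by (intro bump_eq_0) simp
qed

text \<open>The quotient is a weighted mean of \<open>F\<close> over a ball of radius sqrt(e) around
  \<open>x\<close>, so uniform continuity on a slightly larger compact ball controls it. The form
  "eventually in \<open>e\<close>" lets one \<open>e\<close> be chosen for a function and all its
  partial derivatives at once.\<close>

lemma mollification_uniform_limit:
  fixes F :: "'a::euclidean_space \<Rightarrow> real"
  assumes F: "continuous_on UNIV F" and "\<epsilon> > 0" and "bounded K"
  shows "\<forall>\<^sub>F e in at_right 0. \<forall>x\<in>K. \<bar>integral (cbox (-One) One) (\<lambda>y. bump e y * F (x - y))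
     / integral (cbox (-One) One) (bump e :: 'a \<Rightarrow> real) - F x\<bar> \<le> \<epsilon>"
proof -
  let ?B = "cbox (-One) One :: 'a set"
  obtain R where R: "\<And>x. x \<in> K \<Longrightarrow> norm x \<le> R"
    using \<open>bounded K\<close> by (auto simp: bounded_iff)
  have "uniformly_continuous_on (cball 0 (R + 1)) F"
    by (intro compact_uniformly_continuous continuous_on_subset[OF F]) auto
  then obtain d where d: "d > 0"
      "\<And>x x'. x \<in> cball 0 (R + 1) \<Longrightarrow> x' \<in> cball 0 (R + 1) \<Longrightarrow> dist x' x < d \<Longrightarrow> dist (F x') (F x) < \<epsilon>"
    unfolding uniformly_continuous_on_def using \<open>\<epsilon> > 0\<close> by metis
  have "\<bar>integral ?B (\<lambda>y. bump e y * F (x - y)) / integral ?B (bump e) - F x\<bar> \<le> \<epsilon>"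
    \<comment> \<open>The kernel lives on |y|^2 < e, so \<open>e < d\<^sup>2\<close> puts its radius
      below \<open>d\<close>, and \<open>e \<le> 1\<close> keeps \<open>x - y\<close> in the ball of
      radius \<open>R + 1\<close>.\<close>
    if e: "0 < e" "e \<le> 1" "e < d\<^sup>2" and x: "x \<in> K" for e x
  proof -
    let ?I = "integral ?B (bump e :: 'a \<Rightarrow> real)"
    have I: "?I > 0" using bump_integral_pos[OF e(1,2)] .
    have cF: "continuous_on S (\<lambda>y. F (x - y))" for S
      by (intro continuous_on_compose2[OF F] continuous_intros) auto
    have i1: "(\<lambda>y. bump e y * F (x - y)) integrable_on ?B"
      by (intro integrable_continuous continuous_on_mult continuous_bump cF)
    have i2: "(\<lambda>y. bump e y * F x) integrable_on ?B"
      by (intro integrable_continuous continuous_on_mult continuous_bump continuous_intros)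
    have i3: "(\<lambda>y. bump e y * \<epsilon>) integrable_on ?B"
      by (intro integrable_continuous continuous_on_mult continuous_bump continuous_intros)
    have "integral ?B (\<lambda>y. bump e y * F (x - y)) - ?I * F x
        = integral ?B (\<lambda>y. bump e y * F (x - y) - bump e y * F x)"
      using i1 i2 by (simp add: integral_diff)
    also have "norm \<dots> \<le> integral ?B (\<lambda>y. bump e y * \<epsilon>)"
    proof (rule integral_norm_bound_integral)
      show "norm (bump e y * F (x - y) - bump e y * F x) \<le> bump e y * \<epsilon>" for y :: 'a
      proof (cases "y \<bullet> y < e")
        case True
        then have "(norm y)\<^sup>2 < d\<^sup>2" "(norm y)\<^sup>2 < 1\<^sup>2" using e by (auto simp: power2_norm_eq_inner)
        then have "norm y < d" "norm y < 1"
          using d(1) power_less_imp_less_base[of "norm y" 2] by force+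
        moreover have "norm (x - y) \<le> R + 1"
          using norm_triangle_ineq4[of x y] R[OF x] \<open>norm y < 1\<close> by linarith
        ultimately have "\<bar>F (x - y) - F x\<bar> < \<epsilon>"
          using d(2)[of x "x - y"] R[OF x] by (auto simp: dist_norm norm_minus_commute)
        then show ?thesis
          by (simp add: right_diff_distrib[symmetric] abs_mult bump_nonneg mult_left_mono)
      qed (simp add: bump_eq_0)
    qed (use i1 i2 i3 in \<open>auto intro: integrable_diff\<close>)
    also have "\<dots> = ?I * \<epsilon>" by simp
    finally have "\<bar>integral ?B (\<lambda>y. bump e y * F (x - y)) - ?I * F x\<bar> \<le> ?I * \<epsilon>"
      by simp
    moreover have "integral ?B (\<lambda>y. bump e y * F (x - y)) / ?I - F x
       = (integral ?B (\<lambda>y. bump e y * F (x - y)) - ?I * F x) / ?I"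
      using I by (simp add: field_simps)
    ultimately show ?thesis
      using I by (simp add: abs_divide pos_divide_le_eq mult.commute)
  qed
  then show ?thesis
    unfolding eventually_at_right_field using d(1)
    by (intro exI[of _ "min 1 (d\<^sup>2)"]) auto
qed

section \<open>Cutoff and approximation of once differentiable functions by test functions\<close>

lemma DERIV_max_0_square: "((\<lambda>t. (max 0 t)\<^sup>2) has_real_derivative 2 * max 0 t) (at t)"
proof -
  consider "t > 0" | "t = 0" | "t < 0" by linarith
  then show ?thesis
  proof cases
    case 1
    have "((\<lambda>t. t\<^sup>2) has_real_derivative 2 * max 0 t) (at t)"
      using 1 by (auto intro!: derivative_eq_intros)
    moreover have "\<forall>\<^sub>F s in nhds t. (max 0 s)\<^sup>2 = s\<^sup>2"
      using 1 eventually_nhds_in_open[of "{0<..}" t] by (auto elim!: eventually_mono)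
    ultimately show ?thesis
      using DERIV_cong_ev[of t t "\<lambda>t. (max 0 t)\<^sup>2"] by simp
  next
    case 2
    have "((\<lambda>y::real. max 0 y) \<longlongrightarrow> max 0 0) (at 0)"
      by (intro tendsto_intros)
    moreover have "\<forall>\<^sub>F y::real in at 0. max 0 y = (max 0 y)\<^sup>2 / y"
      by (intro always_eventually) (auto simp: max_def power2_eq_square)
    ultimately have "((\<lambda>y::real. (max 0 y)\<^sup>2 / y) \<longlongrightarrow> 0) (at 0)"
      using Lim_transform_eventually by fastforce
    then show ?thesis
      using 2 by (simp add: has_field_derivative_iff)
  next
    case 3
    have "\<forall>\<^sub>F s in nhds t. (max 0 s)\<^sup>2 = 0"
      using 3 eventually_nhds_in_open[of "{..<0}" t] by (auto elim!: eventually_mono)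
    then show ?thesis
      using 3 DERIV_cong_ev[of t t "\<lambda>t. (max 0 t)\<^sup>2" "\<lambda>_. 0" 0] by simp
  qed
qed

lemma Ck_1_max_0_square:
  fixes F :: "'a::euclidean_space \<Rightarrow> real"
  assumes "Ck 1 F"
  shows "Ck 1 (\<lambda>x. (max 0 (F x))\<^sup>2)"
proof -
  have "Ck (Suc 0) (\<lambda>x. (max 0 (F x))\<^sup>2)"
  proof (rule Ck_SucI)
    show "((\<lambda>x. (max 0 (F x))\<^sup>2) has_derivative (\<lambda>v. 2 * max 0 (F x) * frechet_derivative F (at x) v)) (at x)" for x
      using DERIV_compose_FDERIV[OF DERIV_max_0_square, of F _ x UNIV] assms Ck_has_derivative[of 0 F x]
      by (simp add: mult.commute)
    show "Ck 0 (\<lambda>x. 2 * max 0 (F x) * frechet_derivative F (at x) v)" for v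
      using assms Ck_continuous[OF assms, of UNIV]
      by (auto intro!: continuous_intros)
  qed
  then show ?thesis by simp
qed

text \<open>Squaring removes the kink of \<open>max 0\<close>, and one continuous derivative is
  enough because the cutoff is applied before mollification. With \<open>?F\<close> = M + 1 - |x|^2
  the inner square is 0 where \<open>?F\<close> exceeds 1 and at least 1 where \<open>?F\<close> is
  nonpositive; the outer square turns these into the values 1 and 0.\<close>

lemma Ck_1_cutoff:
  obtains h :: "'a::euclidean_space \<Rightarrow> real" where "Ck 1 h"
    "\<And>x. x \<bullet> x < M \<Longrightarrow> h x = 1" "\<And>x. x \<bullet> x \<ge> M + 1 \<Longrightarrow> h x = 0"
proof
  let ?F = "\<lambda>x::'a. M + 1 - x \<bullet> x"
  let ?c = "\<lambda>x. (max 0 (1 + (-1) * (max 0 (1 + (-1) * ?F x))\<^sup>2))\<^sup>2"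
  have "Ck (Suc 0) ?F"
  proof (rule Ck_SucI)
    show "(?F has_derivative (\<lambda>v. (-2) *\<^sub>R (x \<bullet> v))) (at x)" for x
      by (auto intro!: derivative_eq_intros simp: inner_commute)
  qed (intro Ck_scaleR Ck_const Ck_bounded_linear bounded_linear_inner_left)
  then have "Ck 1 ?F" by simp
  then show "Ck 1 ?c"
    by (intro Ck_1_max_0_square Ck_add Ck_mult Ck_const)
  show "x \<bullet> x < M \<Longrightarrow> ?c x = 1" for x
    by (simp add: max_def)
  show "x \<bullet> x \<ge> M + 1 \<Longrightarrow> ?c x = 0" for x
  proof -
    assume "x \<bullet> x \<ge> M + 1"
    then have "(max 0 (1 + (-1) * ?F x))\<^sup>2 \<ge> 1\<^sup>2"
      by (intro power_mono) auto
    then show "?c x = 0" by (simp add: max_def)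
  qed
qed

lemma Cc_inf_C1_dense:
  fixes \<phi> :: "real^'n \<Rightarrow> real"
  assumes \<phi>: "Ck 1 \<phi>" and K: "bounded K" and "\<epsilon> > 0"
  shows "\<exists>\<psi>\<in>Cc_inf. \<forall>x\<in>K. \<bar>\<psi> x - \<phi> x\<bar> \<le> \<epsilon> \<and> norm (grad \<psi> x - grad \<phi> x) \<le> \<epsilon>"
proof -
  obtain R where R: "R > 0" "\<And>x. x \<in> K \<Longrightarrow> norm x < R"
    using K bounded_pos_less by metis
  obtain h :: "real^'n \<Rightarrow> real" where h: "Ck 1 h"
    "\<And>x. x \<bullet> x < R\<^sup>2 \<Longrightarrow> h x = 1" "\<And>x. x \<bullet> x \<ge> R\<^sup>2 + 1 \<Longrightarrow> h x = 0"
    using Ck_1_cutoff[of "R\<^sup>2"] by metis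
  define F where "F x = \<phi> x * h x" for x
  have F: "Ck 1 F" unfolding F_def by (intro Ck_mult \<phi> h)
  note cF = Ck_continuous[OF F]
  \<comment> \<open>Since (R + 1)^2 is at least R^2 + 1, the cutoff vanishes beyond radius
    \<open>c\<close>.\<close>
  define c where "c = R + 1"
  have F0: "F y = 0" if "norm y \<ge> c" for y
  proof -
    have "(norm y)\<^sup>2 \<ge> (R + 1)\<^sup>2" using that R(1) by (intro power_mono) (auto simp: c_def)
    moreover have "(R + 1)\<^sup>2 \<ge> R\<^sup>2 + 1" using R(1) by (simp add: power2_sum)
    ultimately show ?thesis by (auto simp: F_def power2_norm_eq_inner intro!: h)
  qed
  have FK: "F x = \<phi> x" "frechet_derivative F (at x) = frechet_derivative \<phi> (at x)" if "x \<in> K" for x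
  proof -
    \<comment> \<open>Agreement is needed on an open ball containing \<open>K\<close>, not just on
      \<open>K\<close>, to transfer the derivative as well.\<close>
    have eq: "F y = \<phi> y" if "y \<in> ball 0 R" for y
    proof -
      have "(norm y)\<^sup>2 < R\<^sup>2" using that R(1) by (intro power_strict_mono) auto
      then show ?thesis by (simp add: F_def h power2_norm_eq_inner)
    qed
    then show "F x = \<phi> x" using R(2)[OF that] by simp
    have "(\<phi> has_derivative frechet_derivative \<phi> (at x)) (at x)"
      using \<phi> Ck_has_derivative[of 0] by simp
    then have "(F has_derivative frechet_derivative \<phi> (at x)) (at x)"
      by (rule has_derivative_transform_within_open[of _ _ _ _ "ball 0 R"]) (use R(2)[OF that] eq in auto)
    then show "frechet_derivative F (at x) = frechet_derivative \<phi> (at x)"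
      by (rule frechet_derivative_at[symmetric])
  qed
  let ?B = "cbox (-One) One :: (real^'n) set"
  let ?I = "\<lambda>e. integral ?B (bump e)"
  define \<psi> where "\<psi> e x = integral ?B (\<lambda>y. bump e y * F (x - y)) / ?I e" for e x
  \<comment> \<open>The gradient is estimated by the sum of its \<open>CARD('n)\<close> components,
    each allowed an equal share of \<open>\<epsilon>\<close>.\<close>
  define \<delta> where "\<delta> = \<epsilon> / real CARD('n)"
  have "\<delta> > 0" using \<open>\<epsilon> > 0\<close> by (simp add: \<delta>_def)
  have "\<forall>\<^sub>F e in at_right 0. \<forall>i\<in>UNIV::'n set. \<forall>x\<in>K.
     \<bar>integral ?B (\<lambda>y. bump e y * frechet_derivative F (at (x - y)) (axis i 1)) / ?I e
        - frechet_derivative F (at x) (axis i 1)\<bar> \<le> \<delta>"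
    by (intro eventually_ball_finite ballI mollification_uniform_limit \<open>\<delta> > 0\<close> K) (use F in auto)
  moreover have "\<forall>\<^sub>F e in at_right 0. \<forall>x\<in>K. \<bar>\<psi> e x - F x\<bar> \<le> \<epsilon>"
    unfolding \<psi>_def by (intro mollification_uniform_limit cF \<open>\<epsilon> > 0\<close> K)
  moreover have "\<forall>\<^sub>F e in at_right (0::real). 0 < e \<and> e < 1"
    unfolding eventually_at_right_field by (intro exI[of _ 1]) auto
  ultimately have "\<forall>\<^sub>F e in at_right (0::real). (\<forall>i\<in>UNIV::'n set. \<forall>x\<in>K.
     \<bar>integral ?B (\<lambda>y. bump e y * frechet_derivative F (at (x - y)) (axis i 1)) / ?I e
        - frechet_derivative F (at x) (axis i 1)\<bar> \<le> \<delta>) \<and> (\<forall>x\<in>K. \<bar>\<psi> e x - F x\<bar> \<le> \<epsilon>) \<and> 0 < e \<and> e < 1"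
    by eventually_elim blast
  from eventually_happens'[OF trivial_limit_at_right_real this] obtain e where
    e1: "\<And>i x. x \<in> K \<Longrightarrow> \<bar>integral ?B (\<lambda>y. bump e y * frechet_derivative F (at (x - y)) (axis i 1)) / ?I e
        - frechet_derivative F (at x) (axis i 1)\<bar> \<le> \<delta>"
    and e2: "\<And>x. x \<in> K \<Longrightarrow> \<bar>\<psi> e x - F x\<bar> \<le> \<epsilon>" and e: "0 < e" "e < 1"
    by blast
  have D\<psi>: "(\<psi> e has_derivative (\<lambda>v. integral ?B (\<lambda>y. bump e y * frechet_derivative F (at (x - y)) v) / ?I e)) (at x)" for x
    unfolding \<psi>_def[abs_def] divide_inverse
    by (rule has_derivative_mult_left[OF convolution_has_derivative[OF F continuous_bump]])
  \<comment> \<open>Differentiating on \<open>F\<close> stops after one order. With the kernel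
    carrying \<open>x\<close>, all derivatives exist.\<close>
  have "\<psi> e x = (1 / ?I e) *\<^sub>R integral (cbox (-(c *\<^sub>R One)) (c *\<^sub>R One)) (\<lambda>y. F y * bump e (x - y))" for x
  proof -
    have "F y = 0" if y: "y \<notin> cbox (-(c *\<^sub>R One)) (c *\<^sub>R One)" for y
    proof -
      obtain i where "i \<in> Basis" "\<bar>y \<bullet> i\<bar> > c"
        using y by (auto simp: mem_box abs_less_iff not_le inner_sum_left_Basis)
      then show ?thesis using Basis_le_norm[of i y] by (intro F0) linarith
    qed
    then have "integral (cbox (-(c *\<^sub>R One)) (c *\<^sub>R One)) (\<lambda>y. F y * bump e (x - y))
        = integral ?B (\<lambda>y. bump e y * F (x - y))"
      by (rule convolution_commute[OF cF continuous_bump]) (use e in \<open>auto intro: bump_eq_0_outside_box\<close>)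
    then show ?thesis by (simp add: \<psi>_def)
  qed
  then have "smooth (\<psi> e)"
    using smooth_scaleR_const[OF smooth_convolution[OF cF smooth_bump[of e]]] by presburger
  moreover have "{x. \<psi> e x \<noteq> 0} \<subseteq> cball 0 (c + 1)"
  proof -
    have "\<psi> e x = 0" if x: "norm x > c + 1" for x
    proof -
      have "bump e y * F (x - y) = 0" for y
      proof (cases "y \<bullet> y < e")
        case True
        then have "(norm y)\<^sup>2 < 1\<^sup>2" using e by (auto simp: power2_norm_eq_inner)
        then have "norm y < 1" using power_less_imp_less_base[of "norm y" 2 1] by simp
        then show ?thesis using norm_triangle_ineq2[of x y] x by (simp add: F0)
      qed (simp add: bump_eq_0)
      then show ?thesis by (simp only: \<psi>_def) simp
    qed
    then show ?thesis by force
  qed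
  then have "compact (tsupport (\<psi> e))"
    unfolding tsupport_def using bounded_cball bounded_subset compact_closure by blast
  ultimately have "\<psi> e \<in> Cc_inf" by (simp add: Cc_inf_def)
  moreover have "\<bar>\<psi> e x - \<phi> x\<bar> \<le> \<epsilon>" "norm (grad (\<psi> e) x - grad \<phi> x) \<le> \<epsilon>" if x: "x \<in> K" for x
  proof -
    show "\<bar>\<psi> e x - \<phi> x\<bar> \<le> \<epsilon>" using e2[OF x] FK[OF x] by simp
    have "norm (grad (\<psi> e) x - grad \<phi> x) \<le> (\<Sum>i\<in>UNIV. \<bar>(grad (\<psi> e) x - grad \<phi> x) $ i\<bar>)"
      by (rule norm_le_l1_cart)
    also have "\<dots> \<le> (\<Sum>i\<in>(UNIV::'n set). \<delta>)"
      by (rule sum_mono)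
        (use e1[OF x] FK(2)[OF x] in \<open>simp add: grad_def frechet_derivative_at[OF D\<psi>, symmetric]\<close>)
    also have "\<dots> = \<epsilon>" by (simp add: \<delta>_def)
    finally show "norm (grad (\<psi> e) x - grad \<phi> x) \<le> \<epsilon>" .
  qed
  ultimately show ?thesis by blast
qed

subsection \<open>Hausdorff measure of compact manifolds\<close>

text \<open>A certificate for finite Hausdorff measure: covers by finitely many sets at every scale,
  with a common bound on the content. Finite covers combine by plain union, which is all a
  compactness argument needs, so no subadditivity of \<open>hausdorff\<close> has to be
  proved.\<close>

definition finite_content :: "nat \<Rightarrow> 'a::metric_space set \<Rightarrow> bool" where
  "finite_content k E \<longleftrightarrow> (\<exists>M. \<forall>\<delta>>0. \<exists>\<C>. finite \<C> \<and> E \<subseteq> \<Union>\<C> \<and>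
     (\<forall>C\<in>\<C>. bounded C \<and> diameter C \<le> \<delta>) \<and> (\<Sum>C\<in>\<C>. diameter C ^ k) \<le> M)"

lemma finite_content_empty: "finite_content k {}"
  unfolding finite_content_def by (intro exI[of _ 0] allI impI exI[of _ "{}"]) auto

lemma finite_content_subset: "finite_content k E \<Longrightarrow> E' \<subseteq> E \<Longrightarrow> finite_content k E'"
  unfolding finite_content_def by (meson subset_trans)

lemma finite_content_Un:
  assumes "finite_content k E" "finite_content k E'"
  shows "finite_content k (E \<union> E')"
proof -
  obtain M where M: "\<And>\<delta>. \<delta> > 0 \<Longrightarrow> \<exists>\<C>. finite \<C> \<and> E \<subseteq> \<Union>\<C> \<and>
     (\<forall>C\<in>\<C>. bounded C \<and> diameter C \<le> \<delta>) \<and> (\<Sum>C\<in>\<C>. diameter C ^ k) \<le> M"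
    using assms(1) unfolding finite_content_def by blast
  obtain M' where M': "\<And>\<delta>. \<delta> > 0 \<Longrightarrow> \<exists>\<C>. finite \<C> \<and> E' \<subseteq> \<Union>\<C> \<and>
     (\<forall>C\<in>\<C>. bounded C \<and> diameter C \<le> \<delta>) \<and> (\<Sum>C\<in>\<C>. diameter C ^ k) \<le> M'"
    using assms(2) unfolding finite_content_def by blast
  have "\<exists>\<C>. finite \<C> \<and> E \<union> E' \<subseteq> \<Union>\<C> \<and>
     (\<forall>C\<in>\<C>. bounded C \<and> diameter C \<le> \<delta>) \<and> (\<Sum>C\<in>\<C>. diameter C ^ k) \<le> M + M'" if \<delta>: "\<delta> > 0" for \<delta>
  proof -
    obtain \<C> where C: "finite \<C>" "E \<subseteq> \<Union>\<C>" "\<forall>C\<in>\<C>. bounded C \<and> diameter C \<le> \<delta>" "(\<Sum>C\<in>\<C>. diameter C ^ k) \<le> M"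
      using M[OF \<delta>] by blast
    obtain \<C>' where C': "finite \<C>'" "E' \<subseteq> \<Union>\<C>'" "\<forall>C\<in>\<C>'. bounded C \<and> diameter C \<le> \<delta>" "(\<Sum>C\<in>\<C>'. diameter C ^ k) \<le> M'"
      using M'[OF \<delta>] by blast
    \<comment> \<open>Covers are sets of sets and may share members. Adding the nonnegative sum over
      the common members makes the right-hand side equal to the two separate sums.\<close>
    have "(\<Sum>C\<in>\<C> \<union> \<C>'. diameter C ^ k) \<le> (\<Sum>C\<in>\<C> \<union> \<C>'. diameter C ^ k) + (\<Sum>C\<in>\<C> \<inter> \<C>'. diameter C ^ k)"
      using C(3) by (auto intro!: sum_nonneg diameter_ge_0 zero_le_power)
    also have "\<dots> \<le> M + M'"
      using C(1,4) C'(1,4) by (simp add: sum.union_inter)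
    finally show ?thesis
      using C C' by (intro exI[of _ "\<C> \<union> \<C>'"]) auto
  qed
  then show ?thesis unfolding finite_content_def by blast
qed

lemma finite_content_UN: "finite I \<Longrightarrow> (\<And>i. i \<in> I \<Longrightarrow> finite_content k (E i)) \<Longrightarrow> finite_content k (\<Union>i\<in>I. E i)"
  by (induction I rule: finite_induct) (auto intro: finite_content_empty finite_content_Un)

lemma omega_k_nonneg: "0 \<le> omega_k k"
  unfolding omega_k_def by (intro divide_nonneg_nonneg less_imp_le[OF Gamma_real_pos]) auto

lemma hausdorff_less_top:
  assumes "finite_content k E"
  shows "hausdorff k E < \<infinity>"
proof -
  obtain M where M: "\<And>\<delta>. \<delta> > 0 \<Longrightarrow> \<exists>\<C>. finite \<C> \<and> E \<subseteq> \<Union>\<C> \<and>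
     (\<forall>C\<in>\<C>. bounded C \<and> diameter C \<le> \<delta>) \<and> (\<Sum>C\<in>\<C>. diameter C ^ k) \<le> M"
    using assms unfolding finite_content_def by blast
  define w where "w C = (if C = {} then 0 else ennreal (omega_k k * (diameter C / 2) ^ k))" for C :: "'a set"
  have "hausdorff_delta k \<delta> E \<le> ennreal (omega_k k / 2 ^ k * M)" if \<delta>: "\<delta> > 0" for \<delta>
  proof -
    obtain \<C> where C: "finite \<C>" "E \<subseteq> \<Union>\<C>" "\<forall>C\<in>\<C>. bounded C \<and> diameter C \<le> \<delta>" "(\<Sum>C\<in>\<C>. diameter C ^ k) \<le> M"
      using M[OF \<delta>] by blast
    obtain Cs where Cs: "set Cs = \<C>" "distinct Cs"
      using finite_distinct_list[OF C(1)] by blast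
    \<comment> \<open>Padding the cover with empty sets is free because
      \<open>hausdorff_delta\<close> gives \<open>{}\<close> weight 0 explicitly; for
      \<open>k = 0\<close> the power alone would give \<open>0 ^ 0 = 1\<close>.\<close>
    define D where "D i = (if i < length Cs then Cs ! i else {})" for i
    have "E \<subseteq> (\<Union>i. D i)"
    proof
      fix x assume "x \<in> E"
      then obtain C where "C \<in> \<C>" "x \<in> C" using C(2) by blast
      then obtain i where "i < length Cs" "Cs ! i = C" using Cs(1) by (auto simp: in_set_conv_nth)
      then show "x \<in> (\<Union>i. D i)" using \<open>x \<in> C\<close> by (auto simp: D_def intro!: exI[of _ i])
    qed
    moreover have "\<forall>i. bounded (D i) \<and> diameter (D i) \<le> \<delta>"
      using C(3) Cs(1) \<delta> nth_mem by (fastforce simp: D_def)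
    ultimately have "hausdorff_delta k \<delta> E \<le> (\<Sum>i. w (D i))"
      unfolding hausdorff_delta_def w_def by (intro INF_lower) simp
    also have "\<dots> = (\<Sum>i<length Cs. w (D i))"
      by (rule suminf_finite) (auto simp: D_def w_def)
    also have "\<dots> = (\<Sum>C\<in>\<C>. w C)"
      using sum.reindex_bij_betw[OF bij_betw_nth[OF Cs(2) refl Cs(1)[symmetric]], of w]
      by (simp add: D_def)
    also have "\<dots> \<le> (\<Sum>C\<in>\<C>. ennreal (omega_k k / 2 ^ k * diameter C ^ k))"
      by (rule sum_mono) (simp add: w_def power_divide)
    also have "\<dots> = ennreal (\<Sum>C\<in>\<C>. omega_k k / 2 ^ k * diameter C ^ k)"
      using C(3) by (intro sum_ennreal) (auto intro!: mult_nonneg_nonneg simp: omega_k_nonneg diameter_ge_0)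
    also have "\<dots> \<le> ennreal (omega_k k / 2 ^ k * M)"
      unfolding sum_distrib_left[symmetric]
      using C(4) omega_k_nonneg by (intro ennreal_leI mult_left_mono divide_nonneg_nonneg) auto
    finally show ?thesis .
  qed
  then have "hausdorff k E \<le> ennreal (omega_k k / 2 ^ k * M)"
    unfolding hausdorff_def by (intro SUP_least) auto
  then show ?thesis unfolding infinity_ennreal_def by (rule le_less_trans) (rule ennreal_less_top)
qed

text \<open>Subdividing the cube into \<open>m ^ k\<close> cubes of side \<open>s / m\<close> gives covers whose content does not depend on \<open>m\<close>.\<close>

lemma finite_content_Lipschitz_image_cube:
  fixes \<phi> :: "real^'n \<Rightarrow> 'a::metric_space" and B :: "'n set" and a :: "real^'n" and s :: real
  defines "Q \<equiv> {q \<in> coord_space B. \<forall>i\<in>B. a $ i \<le> q $ i \<and> q $ i \<le> a $ i + s}"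
  assumes L: "\<And>p q. p \<in> Q \<Longrightarrow> q \<in> Q \<Longrightarrow> dist (\<phi> p) (\<phi> q) \<le> L * dist p q"
    and "L \<ge> 0" "s > 0"
  shows "finite_content (card B) (\<phi> ` Q)"
proof -
  define N where "N = real CARD('n)"
  have "N > 0" by (simp add: N_def)
  have "\<exists>\<C>. finite \<C> \<and> \<phi> ` Q \<subseteq> \<Union>\<C> \<and>
     (\<forall>C\<in>\<C>. bounded C \<and> diameter C \<le> \<delta>) \<and> (\<Sum>C\<in>\<C>. diameter C ^ card B) \<le> (L * N * s) ^ card B"
    if \<delta>: "\<delta> > 0" for \<delta>
  proof -
    \<comment> \<open>The number of subdivisions is chosen so that the image of one cell has
      diameter at most \<open>\<delta>\<close>: a cell has diameter at most
      \<open>N * (s / m)\<close> by the sum of coordinate differences, and \<open>\<phi>\<close>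
      expands it by at most \<open>L\<close>. The successor keeps \<open>m\<close> positive.\<close>
    obtain m0 :: nat where m0: "L * N * s / \<delta> < real m0" using reals_Archimedean2 by blast
    define m where "m = Suc m0"
    have m: "m > 0" "L * N * (s / m) \<le> \<delta>"
    proof -
      have "L * N * s < real m * \<delta>"
        using m0 \<delta> by (simp add: m_def pos_divide_less_eq) (simp add: algebra_simps)
      then show "L * N * (s / m) \<le> \<delta>" by (simp add: m_def field_simps)
    qed (simp add: m_def)
    define cell where "cell c = {q \<in> Q. \<forall>i\<in>B. a $ i + c i * (s / m) \<le> q $ i \<and> q $ i \<le> a $ i + (c i + 1) * (s / m)}"
      for c :: "'n \<Rightarrow> nat"
    define P where "P = (B \<rightarrow>\<^sub>E {..<m})"
    define \<C> where "\<C> = (\<lambda>c. \<phi> ` cell c) ` P"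
    have "finite P" unfolding P_def by (intro finite_PiE) auto
    have "card \<C> \<le> m ^ card B"
    proof -
      have "card \<C> \<le> card P" unfolding \<C>_def by (rule card_image_le[OF \<open>finite P\<close>])
      also have "\<dots> = m ^ card B" by (simp add: P_def card_PiE)
      finally show ?thesis .
    qed
    have d: "dist (\<phi> p) (\<phi> q) \<le> L * N * (s / m)" if "p \<in> cell c" "q \<in> cell c" for p q c
    proof -
      have "\<bar>(p - q) $ i\<bar> \<le> s / m" for i
      proof (cases "i \<in> B")
        case True
        then have "a $ i + c i * (s / m) \<le> p $ i" "p $ i \<le> a $ i + (c i + 1) * (s / m)"
            "a $ i + c i * (s / m) \<le> q $ i" "q $ i \<le> a $ i + (c i + 1) * (s / m)"
          using that unfolding cell_def by blast+
        then show ?thesis by (simp add: distrib_right) argo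
      next
        case False
        then show ?thesis using that \<open>s > 0\<close> by (simp add: cell_def Q_def coord_space_def)
      qed
      then have "(\<Sum>i\<in>UNIV. \<bar>(p - q) $ i\<bar>) \<le> (\<Sum>i\<in>(UNIV::'n set). s / m)"
        by (intro sum_mono)
      then have "dist p q \<le> N * (s / m)"
        using norm_le_l1_cart[of "p - q"] by (simp add: dist_norm N_def)
      then have "L * dist p q \<le> L * (N * (s / m))"
        using \<open>L \<ge> 0\<close> by (rule mult_left_mono)
      then show ?thesis
        using L[of p q] that by (simp add: cell_def)
    qed
    have bd: "bounded C" "diameter C \<le> L * N * (s / m)" if "C \<in> \<C>" for C
    proof -
      obtain c where c: "C = \<phi> ` cell c" using \<open>C \<in> \<C>\<close> unfolding \<C>_def by blast
      show "bounded C" unfolding c bounded_two_points using d by blast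
      have "L * N * (s / m) \<ge> 0" using \<open>L \<ge> 0\<close> \<open>s > 0\<close> \<open>N > 0\<close> by simp
      then show "diameter C \<le> L * N * (s / m)"
        unfolding diameter_def using d by (auto simp: c intro!: cSUP_least)
    qed
    have cov: "\<phi> ` Q \<subseteq> \<Union>\<C>"
    proof (rule image_subsetI)
      fix q assume q: "q \<in> Q"
      define t where "t i = (q $ i - a $ i) / (s / m)" for i
      \<comment> \<open>On the far face \<open>t i = m\<close> the floor would give the index
        \<open>m\<close>, outside the grid; the minimum moves such points into the last cell, which
        is closed and contains them.\<close>
      define c where "c = restrict (\<lambda>i. min (nat \<lfloor>t i\<rfloor>) (m - 1)) B"
      have "a $ i + c i * (s / m) \<le> q $ i \<and> q $ i \<le> a $ i + (c i + 1) * (s / m)" if i: "i \<in> B" for i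
      proof -
        have "0 \<le> q $ i - a $ i" "q $ i - a $ i \<le> s" using q i by (auto simp: Q_def)
        then have t: "0 \<le> t i" "t i \<le> m"
          using m(1) \<open>s > 0\<close> by (auto simp: t_def divide_simps)
        have "real (c i) \<le> t i \<and> t i \<le> real (c i) + 1"
        proof (cases "nat \<lfloor>t i\<rfloor> \<le> m - 1")
          case True
          then have "real (c i) = of_int \<lfloor>t i\<rfloor>" using i t by (simp add: c_def min_def)
          then show ?thesis by linarith
        next
          case False
          then have "c i = m - 1" using i by (simp add: c_def min_def)
          moreover have "real m \<le> t i" using False t(1) by linarith
          ultimately show ?thesis using t m(1) by (simp add: of_nat_diff)
        qed
        then have "real (c i) * (s / m) \<le> t i * (s / m)" "t i * (s / m) \<le> (real (c i) + 1) * (s / m)"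
          using \<open>s > 0\<close> by (intro mult_right_mono; simp)+
        moreover have "t i * (s / m) = q $ i - a $ i"
          using m(1) \<open>s > 0\<close> by (simp add: t_def)
        ultimately show ?thesis unfolding of_nat_add of_nat_1 by linarith
      qed
      then have "q \<in> cell c" using q by (simp add: cell_def)
      moreover have "c \<in> P" using m(1) by (auto simp: P_def c_def)
      ultimately show "\<phi> q \<in> \<Union>\<C>" by (auto simp: \<C>_def)
    qed
    have "(\<Sum>C\<in>\<C>. diameter C ^ card B) \<le> (\<Sum>C\<in>\<C>. (L * N * (s / m)) ^ card B)"
      using bd by (intro sum_mono power_mono diameter_ge_0) auto
    also have "\<dots> = card \<C> * (L * N * (s / m)) ^ card B" by simp
    also have "\<dots> \<le> (real m ^ card B) * (L * N * (s / m)) ^ card B"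
    proof (rule mult_right_mono)
      show "real (card \<C>) \<le> real m ^ card B"
        using \<open>card \<C> \<le> m ^ card B\<close> by (metis of_nat_le_iff of_nat_power)
    qed (use \<open>L \<ge> 0\<close> \<open>s > 0\<close> \<open>N > 0\<close> in simp)
    also have "\<dots> = (L * N * s) ^ card B"
      using m(1) by (simp add: power_mult_distrib[symmetric])
    finally have "(\<Sum>C\<in>\<C>. diameter C ^ card B) \<le> (L * N * s) ^ card B" .
    moreover have "finite \<C>" using \<open>finite P\<close> by (simp add: \<C>_def)
    ultimately show ?thesis
      using cov bd m(2) by (intro exI[of _ \<C>]) force
  qed
  then show ?thesis unfolding finite_content_def by blast
qed

text \<open>Compactness bounds each partial derivative, hence the operator norm, and convexity of
  the box allows the mean value inequality.\<close>

lemma Ck_1_Lipschitz_on_cbox: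
  fixes \<phi> :: "'a::euclidean_space \<Rightarrow> 'b::real_normed_vector"
  assumes "Ck 1 \<phi>"
  obtains L where "L \<ge> 0" "\<And>p q. p \<in> cbox a b \<Longrightarrow> q \<in> cbox a b \<Longrightarrow> dist (\<phi> p) (\<phi> q) \<le> L * dist p q"
proof -
  let ?D = "\<lambda>x. frechet_derivative \<phi> (at x)"
  have D: "(\<phi> has_derivative ?D x) (at x)" for x
    using assms Ck_has_derivative[of 0] by simp
  have "\<exists>M. \<forall>x\<in>cbox a b. norm (?D x i) \<le> M" for i
  proof -
    have "continuous_on (cbox a b) (\<lambda>x. ?D x i)"
      using assms by (auto intro: continuous_on_subset)
    then have "bounded ((\<lambda>x. ?D x i) ` cbox a b)"
      by (intro compact_imp_bounded compact_continuous_image) auto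
    then show ?thesis by (auto simp: bounded_iff)
  qed
  then obtain M where M: "\<And>i x. x \<in> cbox a b \<Longrightarrow> norm (?D x i) \<le> M i" by metis
  define L where "L = (\<Sum>i\<in>Basis. \<bar>M i\<bar>)"
  have on: "onorm (?D x) \<le> L" if x: "x \<in> cbox a b" for x
  proof (rule onorm_le)
    fix v :: 'a
    interpret bounded_linear "?D x" using D by (rule has_derivative_bounded_linear)
    have "?D x v = ?D x (\<Sum>i\<in>Basis. (v \<bullet> i) *\<^sub>R i)" by (simp add: euclidean_representation)
    also have "norm \<dots> \<le> (\<Sum>i\<in>Basis. \<bar>v \<bullet> i\<bar> * norm (?D x i))"
      by (simp add: sum scaleR) (rule order_trans[OF norm_sum], simp)
    also have "\<dots> \<le> (\<Sum>i\<in>Basis. norm v * \<bar>M i\<bar>)"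
      using M[OF x] by (intro sum_mono mult_mono) (auto simp: Basis_le_norm intro: order_trans[OF _ abs_ge_self])
    also have "\<dots> = L * norm v" by (simp add: L_def sum_distrib_left mult.commute)
    finally show "norm (?D x v) \<le> L * norm v" .
  qed
  show thesis
  proof
    show "L \<ge> 0" by (simp add: L_def sum_nonneg)
    show "dist (\<phi> p) (\<phi> q) \<le> L * dist p q" if "p \<in> cbox a b" "q \<in> cbox a b" for p q
      using differentiable_bound[OF convex_box(1) has_derivative_at_withinI[OF D] on that]
      by (simp add: dist_norm)
  qed
qed

text \<open>The parameter domain \<open>V\<close> need not be convex, but \<open>\<phi>\<close> is
  \<open>C\<^sup>2\<close> on the whole space, so the Lipschitz bound can be taken on a cube around
  the parameter of \<open>x\<close>. This treats interior and boundary charts alike.\<close>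

lemma finite_content_near_chart:
  fixes S :: "(real^'n) set"
  assumes "C2_chart k S x is_int" "x \<in> S"
  obtains W where "open W" "x \<in> W" "finite_content k (S \<inter> W)"
proof -
  obtain B :: "'n set" and U V \<phi> \<psi> where *: "card B = k" "open U" "x \<in> U" "Ck 2 \<phi>"
      "if is_int then openin (top_of_set (coord_space B)) V
         else (\<exists>b\<in>B. openin (top_of_set (half_coord_space B b)) V)"
      and hom: "homeomorphism V (S \<inter> U) \<phi> \<psi>"
    using assms(1) unfolding C2_chart_def by (elim exE conjE) (rule that)
  have V: "V \<subseteq> coord_space B"
    using *(5) openin_imp_subset by (fastforce simp: half_coord_space_def split: if_splits)
  define p where "p = \<psi> x"
  have p: "p \<in> V" "\<phi> p = x"
    using hom assms(2) *(3) by (auto simp: p_def homeomorphism_def)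
  \<comment> \<open>Homeomorphism makes the image of a small piece of \<open>V\<close> relatively
    open, so it contains every point of \<open>S\<close> near \<open>x\<close>.\<close>
  have "openin (top_of_set (S \<inter> U)) (\<phi> ` (V \<inter> ball p 1))"
    by (rule homeomorphism_imp_open_map[OF hom]) (auto intro: openin_open_Int)
  then obtain T where T: "open T" "\<phi> ` (V \<inter> ball p 1) = S \<inter> U \<inter> T"
    by (auto simp: openin_open)
  \<comment> \<open>Here \<open>1\<close> is the vector of ones, so \<open>Q\<close> is the cube of
    side 2 centred at \<open>p\<close> in the coordinate subspace; it contains the part of
    \<open>V\<close> within distance 1 of \<open>p\<close>.\<close>
  define a :: "real^'n" where "a = p - 1"
  define Q where "Q = {q \<in> coord_space B. \<forall>i\<in>B. a $ i \<le> q $ i \<and> q $ i \<le> a $ i + 2}"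
  have "Ck 1 \<phi>" using *(4) Ck_Suc_imp_Ck[of 1 \<phi>] by (simp add: numeral_2_eq_2)
  then obtain L where L: "L \<ge> 0"
      "\<And>q q'. q \<in> cbox a (p + 1) \<Longrightarrow> q' \<in> cbox a (p + 1) \<Longrightarrow> dist (\<phi> q) (\<phi> q') \<le> L * dist q q'"
    using Ck_1_Lipschitz_on_cbox[of \<phi> a "p + 1"] by metis
  have "p $ i = 0" if "i \<notin> B" for i
    using V p(1) that by (auto simp: coord_space_def)
  then have "a $ i \<le> q $ i \<and> q $ i \<le> (p + 1) $ i" if "q \<in> Q" for q i
    using that by (cases "i \<in> B") (auto simp: Q_def a_def coord_space_def)
  then have "Q \<subseteq> cbox a (p + 1)"
    by (auto simp: mem_box_cart)
  then have "dist (\<phi> q) (\<phi> q') \<le> L * dist q q'" if "q \<in> Q" "q' \<in> Q" for q q'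
    using that by (intro L(2)) auto
  then have "finite_content (card B) (\<phi> ` Q)"
    unfolding Q_def using L(1) by (intro finite_content_Lipschitz_image_cube[of _ _ _ _ L]) auto
  moreover have "S \<inter> (U \<inter> T) \<subseteq> \<phi> ` Q"
  proof -
    have "V \<inter> ball p 1 \<subseteq> Q"
    proof
      fix q assume q: "q \<in> V \<inter> ball p 1"
      then have "\<bar>(p - q) $ i\<bar> \<le> 1" for i
        using component_le_norm_cart[of "p - q" i] by (simp add: dist_norm)
      then have "a $ i \<le> q $ i" "q $ i \<le> a $ i + 2" for i
        by (simp_all add: a_def abs_le_iff algebra_simps)
      then show "q \<in> Q" using q V unfolding Q_def by blast
    qed
    then show ?thesis using T(2) by blast
  qed
  ultimately have "finite_content k (S \<inter> (U \<inter> T))"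
    using *(1) finite_content_subset by blast
  moreover have "x \<in> T"
    using T(2) p by force
  ultimately show thesis
    using that[of "U \<inter> T"] *(2,3) T(1) by blast
qed

lemma hausdorff_C2_manifold_less_top:
  assumes "C2_manifold k S"
  shows "hausdorff k S < \<infinity>"
proof -
  have "\<forall>x\<in>S. \<exists>W. open W \<and> x \<in> W \<and> finite_content k (S \<inter> W)"
    using assms finite_content_near_chart unfolding C2_manifold_def by metis
  then obtain W where W: "\<And>x. x \<in> S \<Longrightarrow> open (W x)" "\<And>x. x \<in> S \<Longrightarrow> x \<in> W x"
      "\<And>x. x \<in> S \<Longrightarrow> finite_content k (S \<inter> W x)"
    by metis
  have "compact S" using assms by (simp add: C2_manifold_def)
  moreover have "S \<subseteq> (\<Union>x\<in>S. W x)" using W(2) by blast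
  ultimately obtain F where F: "F \<subseteq> S" "finite F" "S \<subseteq> (\<Union>x\<in>F. W x)"
    using compactE_image[of S S W] W(1) by metis
  have "finite_content k (\<Union>x\<in>F. S \<inter> W x)"
    using F W(3) by (intro finite_content_UN) auto
  moreover have "S \<subseteq> (\<Union>x\<in>F. S \<inter> W x)" using F(3) by blast
  ultimately show ?thesis
    using finite_content_subset hausdorff_less_top by blast
qed

lemma finite_measure_sum_hausdorff_restr:
  fixes J :: nat and S :: "nat \<Rightarrow> (real^'n) set"
  assumes mu: "\<mu> = measure_of UNIV (sets borel) (\<lambda>X. \<Sum>j<J. emeasure (hausdorff_restr (k j) (S j)) X)"
    and "\<And>j. j < J \<Longrightarrow> C2_manifold (k j) (S j)"
  shows "finite_measure \<mu>"
proof
  have "space \<mu> = UNIV" unfolding mu by (simp add: space_measure_of_conv)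
  \<comment> \<open>\<open>measure_of\<close> returns the given set function if that is a measure
    and 0 otherwise. The upper bound holds in both cases, so countable additivity of
    \<open>hausdorff\<close> is not at issue here or in the next estimate.\<close>
  have "emeasure \<mu> UNIV \<le> (\<Sum>j<J. emeasure (hausdorff_restr (k j) (S j)) UNIV)"
    unfolding mu by (subst emeasure_measure_of_conv) simp
  also have "\<dots> \<le> (\<Sum>j<J. hausdorff (k j) (S j))"
    unfolding hausdorff_restr_def by (rule sum_mono, subst emeasure_measure_of_conv) simp
  also have "\<dots> < \<infinity>"
    using hausdorff_C2_manifold_less_top assms(2) by (auto simp: less_top)
  finally show "emeasure \<mu> (space \<mu>) \<noteq> \<infinity>" using \<open>space \<mu> = UNIV\<close> by simp
qed

subsection \<open>The tangential projection\<close>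

lemma has_derivative_Cc_inf:
  "f \<in> Cc_inf \<Longrightarrow> (f has_derivative frechet_derivative f (at x)) (at x)"
  using Ck_has_derivative[of 0 f x] by (simp only: Cc_inf_def smooth_def mem_Collect_eq)

lemma Cc_inf_zero: "(\<lambda>x. 0) \<in> Cc_inf"
  by (simp add: Cc_inf_def smooth_def Ck_const tsupport_def)

lemma Cc_inf_add:
  assumes "f \<in> Cc_inf" "g \<in> Cc_inf"
  shows "(\<lambda>x. f x + g x) \<in> Cc_inf"
proof -
  have "{x. f x + g x \<noteq> 0} \<subseteq> {x. f x \<noteq> 0} \<union> {x. g x \<noteq> 0}" by auto
  then have "tsupport (\<lambda>x. f x + g x) \<subseteq> tsupport f \<union> tsupport g"
    unfolding tsupport_def closure_Un[symmetric] by (rule closure_mono)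
  moreover have "compact (tsupport f \<union> tsupport g)"
    using assms by (simp add: Cc_inf_def compact_Un)
  ultimately have "compact (tsupport (\<lambda>x. f x + g x))"
    using compact_Int_closed[of _ "tsupport (\<lambda>x. f x + g x)"]
    by (metis closed_closure inf.absorb2 tsupport_def)
  then show ?thesis using assms by (simp add: Cc_inf_def smooth_add)
qed

lemma Cc_inf_scaleR:
  assumes "f \<in> Cc_inf"
  shows "(\<lambda>x. c *\<^sub>R f x) \<in> Cc_inf"
proof (cases "c = 0")
  case False
  then have "tsupport (\<lambda>x. c *\<^sub>R f x) = tsupport f" by (simp add: tsupport_def)
  then show ?thesis using assms by (simp add: Cc_inf_def smooth_scaleR_const)
qed (simp add: Cc_inf_zero)

lemma grad_add:
  "f \<in> Cc_inf \<Longrightarrow> g \<in> Cc_inf \<Longrightarrow> grad (\<lambda>y. f y + g y) x = grad f x + grad g x"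
  by (simp add: grad_def vec_eq_iff
      frechet_derivative_at[OF has_derivative_add[OF has_derivative_Cc_inf has_derivative_Cc_inf], symmetric])

lemma grad_scaleR:
  "f \<in> Cc_inf \<Longrightarrow> grad (\<lambda>y. c *\<^sub>R f y) x = c *\<^sub>R grad f x"
  by (simp add: grad_def vec_eq_iff
      frechet_derivative_at[OF has_derivative_mult_right[OF has_derivative_Cc_inf], symmetric])

lemma subspace_Nmu: "subspace (Nmu \<mu> x)"
proof (rule subspaceI)
  have "grad (\<lambda>x. 0) y = 0" for y :: "real^'a"
    by (simp add: grad_def vec_eq_iff)
  then show "0 \<in> Nmu \<mu> x"
    unfolding Nmu_def Nmu_fun_def
    by (intro CollectI exI[of _ "\<lambda>_. 0"] conjI Cc_inf_zero bexI[of _ "\<lambda>_. 0"]) (auto simp: Cc_inf_zero)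
next
  fix a b assume "a \<in> Nmu \<mu> x" "b \<in> Nmu \<mu> x"
  then obtain w v w' v' where *: "a = w x" "w \<in> Cc_inf" "v \<in> Nmu_fun \<mu>" "\<forall>y\<in>msupp \<mu>. w y = grad v y"
    "b = w' x" "w' \<in> Cc_inf" "v' \<in> Nmu_fun \<mu>" "\<forall>y\<in>msupp \<mu>. w' y = grad v' y"
    unfolding Nmu_def by blast
  then show "a + b \<in> Nmu \<mu> x"
    unfolding Nmu_def
    by (intro CollectI exI[of _ "\<lambda>x. w x + w' x"] conjI Cc_inf_add bexI[of _ "\<lambda>x. v x + v' x"])
      (auto simp: Nmu_fun_def grad_add Cc_inf_add)
next
  fix c a assume "a \<in> Nmu \<mu> x"
  then obtain w v where *: "a = w x" "w \<in> Cc_inf" "v \<in> Nmu_fun \<mu>" "\<forall>y\<in>msupp \<mu>. w y = grad v y"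
    unfolding Nmu_def by blast
  then show "c *\<^sub>R a \<in> Nmu \<mu> x"
    unfolding Nmu_def
    using grad_scaleR[of v c] Cc_inf_scaleR[of v c]
    by (intro CollectI exI[of _ "\<lambda>x. c *\<^sub>R w x"] conjI Cc_inf_scaleR bexI[of _ "\<lambda>x. c *\<^sub>R v x"])
      (auto simp: Nmu_fun_def)
qed

lemma subspace_Tmu: "subspace (Tmu \<mu> x)"
  by (rule subspaceI) (auto simp: Tmu_def inner_add_left)

text \<open>Asking for the residual in \<open>Nmu\<close> rather than orthogonal to
  \<open>Tmu\<close> avoids the double orthogonal complement and makes linearity a matter of
  subspace closure.\<close>

lemma Pimu_eqI:
  assumes "p \<in> Tmu \<mu> x" "\<xi> - p \<in> Nmu \<mu> x"
  shows "Pimu \<mu> x \<xi> = p"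
  unfolding Pimu_def
proof (rule the_equality)
  show p: "p \<in> Tmu \<mu> x \<and> (\<forall>t\<in>Tmu \<mu> x. (\<xi> - p) \<bullet> t = 0)"
    using assms by (auto simp: Tmu_def inner_commute)
  fix q assume q: "q \<in> Tmu \<mu> x \<and> (\<forall>t\<in>Tmu \<mu> x. (\<xi> - q) \<bullet> t = 0)"
  then have "q - p \<in> Tmu \<mu> x" using p by (simp add: subspace_diff[OF subspace_Tmu])
  then have "(\<xi> - p) \<bullet> (q - p) - (\<xi> - q) \<bullet> (q - p) = 0" using p q by simp
  then show "q = p" by (simp add: inner_diff_left[symmetric])
qed

text \<open>\<open>Nmu \<mu> x\<close> is a subspace of a finite-dimensional space and equals its
  span, so the orthogonal decomposition along it exists.\<close>

lemma Pimu_in_Tmu: "Pimu \<mu> x \<xi> \<in> Tmu \<mu> x"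
  and diff_Pimu_in_Nmu: "\<xi> - Pimu \<mu> x \<xi> \<in> Nmu \<mu> x"
proof -
  obtain y z where yz: "y \<in> span (Nmu \<mu> x)" "\<And>w. w \<in> span (Nmu \<mu> x) \<Longrightarrow> orthogonal z w" "\<xi> = y + z"
    using orthogonal_subspace_decomp_exists by blast
  have "span (Nmu \<mu> x) = Nmu \<mu> x" by (simp add: span_eq_iff subspace_Nmu)
  with yz have z: "z \<in> Tmu \<mu> x" "\<xi> - z \<in> Nmu \<mu> x"
    by (auto simp: Tmu_def orthogonal_def)
  with Pimu_eqI[OF this] show "Pimu \<mu> x \<xi> \<in> Tmu \<mu> x" "\<xi> - Pimu \<mu> x \<xi> \<in> Nmu \<mu> x"
    by simp_all
qed

lemma linear_Pimu: "linear (Pimu \<mu> x)"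
proof (rule linearI)
  show "Pimu \<mu> x (\<xi> + \<eta>) = Pimu \<mu> x \<xi> + Pimu \<mu> x \<eta>" for \<xi> \<eta>
    using subspace_add[OF subspace_Nmu diff_Pimu_in_Nmu[of \<xi> \<mu> x] diff_Pimu_in_Nmu[of \<eta> \<mu> x]]
    by (intro Pimu_eqI subspace_add[OF subspace_Tmu] Pimu_in_Tmu) (simp add: algebra_simps)
  show "Pimu \<mu> x (c *\<^sub>R \<xi>) = c *\<^sub>R Pimu \<mu> x \<xi>" for c \<xi>
    using subspace_scale[OF subspace_Nmu diff_Pimu_in_Nmu[of \<xi> \<mu> x], of c]
    by (intro Pimu_eqI subspace_scale[OF subspace_Tmu] Pimu_in_Tmu) (simp add: algebra_simps)
qed

lemma Pimu_Nmu_eq_0: "\<eta> \<in> Nmu \<mu> x \<Longrightarrow> Pimu \<mu> x \<eta> = 0"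
  by (intro Pimu_eqI) (auto simp: subspace_0[OF subspace_Tmu])

lemma inner_Pimu_Pimu: "Pimu \<mu> x \<xi> \<bullet> Pimu \<mu> x \<eta> = Pimu \<mu> x \<xi> \<bullet> \<eta>"
proof -
  have "Pimu \<mu> x \<xi> \<bullet> (\<eta> - Pimu \<mu> x \<eta>) = 0"
    using Pimu_in_Tmu diff_Pimu_in_Nmu by (fastforce simp: Tmu_def)
  then show ?thesis by (simp add: inner_diff_right)
qed

lemma inner_Pimu_commute: "Pimu \<mu> x \<xi> \<bullet> \<eta> = \<xi> \<bullet> Pimu \<mu> x \<eta>"
  using inner_Pimu_Pimu[of \<mu> x \<xi> \<eta>] inner_Pimu_Pimu[of \<mu> x \<eta> \<xi>] by (simp add: inner_commute)

lemma norm_Pimu_le: "norm (Pimu \<mu> x \<xi>) \<le> norm \<xi>"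
proof (cases "Pimu \<mu> x \<xi> = 0")
  case False
  have "norm (Pimu \<mu> x \<xi>) * norm (Pimu \<mu> x \<xi>) \<le> norm (Pimu \<mu> x \<xi>) * norm \<xi>"
    using norm_cauchy_schwarz[of "Pimu \<mu> x \<xi>" \<xi>] inner_Pimu_Pimu[of \<mu> x \<xi> \<xi>]
    by (simp add: dot_square_norm power2_eq_square)
  with False show ?thesis by simp
qed simp

text \<open>\<open>norm (Pimu \<mu> x \<xi>)\<close> is the distance of \<open>\<xi>\<close> to \<open>Nmu \<mu> x\<close>, an infimum of continuous functions
  of \<open>x\<close>; hence it is upper semicontinuous.\<close>

lemma open_norm_Pimu_less: "open {x. norm (Pimu \<mu> x \<xi>) < a}"
proof -
  define W where "W = {w \<in> Cc_inf. \<exists>v\<in>Nmu_fun \<mu>. \<forall>y\<in>msupp \<mu>. w y = grad v y}"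
  have Nmu_W: "Nmu \<mu> x = {w x |w. w \<in> W}" for x
    by (auto simp: Nmu_def W_def)
  have "norm (Pimu \<mu> x \<xi>) < a \<longleftrightarrow> (\<exists>w\<in>W. norm (\<xi> - w x) < a)" for x
  proof
    assume "norm (Pimu \<mu> x \<xi>) < a"
    moreover obtain w where "w \<in> W" "\<xi> - Pimu \<mu> x \<xi> = w x"
      using diff_Pimu_in_Nmu[of \<xi> \<mu> x] unfolding Nmu_W by blast
    ultimately show "\<exists>w\<in>W. norm (\<xi> - w x) < a"
      by (metis add_diff_cancel_left' diff_add_cancel)
  next
    assume "\<exists>w\<in>W. norm (\<xi> - w x) < a"
    then obtain w where w: "w x \<in> Nmu \<mu> x" "norm (\<xi> - w x) < a" unfolding Nmu_W by blast
    then have "Pimu \<mu> x \<xi> = Pimu \<mu> x (\<xi> - w x)"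
      by (simp add: linear_diff[OF linear_Pimu] Pimu_Nmu_eq_0)
    then show "norm (Pimu \<mu> x \<xi>) < a"
      using norm_Pimu_le[of \<mu> x "\<xi> - w x"] w(2) by simp
  qed
  then have "{x. norm (Pimu \<mu> x \<xi>) < a} = (\<Union>w\<in>W. {x. norm (\<xi> - w x) < a})" by auto
  moreover have "open {x. norm (\<xi> - w x) < a}" if "w \<in> W" for w
  proof -
    have "Ck 0 w" using that unfolding W_def Cc_inf_def smooth_def by blast
    then have "continuous_on UNIV w" by simp
    then show ?thesis by (intro open_Collect_less continuous_intros)
  qed
  ultimately show ?thesis by auto
qed

text \<open>Open sublevel sets give measurability of the norms only. Polarisation recovers
  \<open>Pimu \<mu> x \<xi> \<bullet> \<eta>\<close> from them, because \<open>Pimu\<close> is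
  linear and self-adjoint.\<close>

lemma borel_measurable_Pimu_const: "(\<lambda>x. Pimu \<mu> x \<xi>) \<in> borel_measurable borel"
proof -
  have n: "(\<lambda>x. norm (Pimu \<mu> x \<eta>)) \<in> borel_measurable borel" for \<eta>
    unfolding borel_measurable_iff_less using borel_open[OF open_norm_Pimu_less[of \<mu> \<eta>]] by simp
  have eq: "Pimu \<mu> x \<xi> \<bullet> \<eta> = ((norm (Pimu \<mu> x (\<xi> + \<eta>)))\<^sup>2 - (norm (Pimu \<mu> x (\<xi> - \<eta>)))\<^sup>2) / 4" for x \<eta>
    by (subst inner_Pimu_Pimu[symmetric]) (simp add: power2_norm_eq_inner linear_add[OF linear_Pimu] linear_diff[OF linear_Pimu]
        inner_add_left inner_add_right inner_diff_left inner_diff_right inner_commute)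
  have "(\<lambda>x. ((norm (Pimu \<mu> x (\<xi> + \<eta>)))\<^sup>2 - (norm (Pimu \<mu> x (\<xi> - \<eta>)))\<^sup>2) / 4) \<in> borel_measurable borel" for \<eta>
    using n by measurable
  then have "(\<lambda>x. Pimu \<mu> x \<xi> \<bullet> \<eta>) \<in> borel_measurable borel" for \<eta>
    unfolding eq .
  then show ?thesis by (simp add: borel_measurable_euclidean_space[of "\<lambda>x. Pimu \<mu> x \<xi>"])
qed

lemma borel_measurable_Pimu:
  assumes M: "(\<lambda>x. x) \<in> borel_measurable M"
    and h: "h \<in> borel_measurable M"
  shows "(\<lambda>x. Pimu \<mu> x (h x)) \<in> borel_measurable M"
proof -
  have "Pimu \<mu> x (h x) = (\<Sum>i\<in>Basis. (h x \<bullet> i) *\<^sub>R Pimu \<mu> x i)" for x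
    by (subst euclidean_representation[symmetric])
      (simp add: linear_sum[OF linear_Pimu] linear_scale[OF linear_Pimu])
  moreover have "(\<lambda>x. \<Sum>i\<in>Basis. (h x \<bullet> i) *\<^sub>R Pimu \<mu> x i) \<in> borel_measurable M"
    using measurable_compose[OF M borel_measurable_Pimu_const] h by measurable
  ultimately show ?thesis by simp
qed

section \<open>The projected coefficient operator\<close>

lemma norm_matrix_vector_mult_le:
  fixes A :: "real^'n^'m"
  shows "norm (A *v x) \<le> norm A * norm x"
proof -
  have "norm (A *v x) = L2_set (\<lambda>i. \<bar>A $ i \<bullet> x\<bar>) UNIV"
    by (simp add: norm_vec_def matrix_vector_mult_def inner_vec_def)
  also have "\<dots> \<le> L2_set (\<lambda>i. norm (A $ i) * norm x) UNIV"
    by (intro L2_set_mono) (auto simp: Cauchy_Schwarz_ineq2)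
  also have "\<dots> = norm A * norm x"
    by (simp add: norm_vec_def[of A] L2_set_left_distrib)
  finally show ?thesis .
qed

lemma norm_A_mu_le: "norm (A_mu \<mu> A x \<xi>) \<le> norm (A x) * norm \<xi>"
proof -
  have "norm (A_mu \<mu> A x \<xi>) \<le> norm (A x *v Pimu \<mu> x \<xi>)"
    unfolding A_mu_def by (rule norm_Pimu_le)
  also have "\<dots> \<le> norm (A x) * norm (Pimu \<mu> x \<xi>)" by (rule norm_matrix_vector_mult_le)
  also have "\<dots> \<le> norm (A x) * norm \<xi>" by (intro mult_left_mono norm_Pimu_le) simp
  finally show ?thesis .
qed

lemma linear_A_mu: "linear (A_mu \<mu> A x)"
  unfolding A_mu_def[abs_def]
  using linear_compose[OF linear_compose[OF linear_Pimu matrix_vector_mul_linear] linear_Pimu]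
  by (simp add: o_def)

lemma inner_A_mu_commute:
  assumes "transpose (A x) = A x"
  shows "A_mu \<mu> A x \<xi> \<bullet> \<eta> = A_mu \<mu> A x \<eta> \<bullet> \<xi>"
proof -
  have "A_mu \<mu> A x \<xi> \<bullet> \<eta> = (A x *v Pimu \<mu> x \<xi>) \<bullet> Pimu \<mu> x \<eta>"
    by (simp add: A_mu_def inner_Pimu_commute)
  also have "\<dots> = Pimu \<mu> x \<xi> \<bullet> (A x *v Pimu \<mu> x \<eta>)"
    using assms dot_lmul_matrix[of "Pimu \<mu> x \<xi>" "A x" "Pimu \<mu> x \<eta>"]
    by (metis transpose_matrix_vector)
  also have "\<dots> = A_mu \<mu> A x \<eta> \<bullet> \<xi>"
    by (simp add: A_mu_def inner_Pimu_commute inner_commute)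
  finally show ?thesis .
qed

text \<open>The outer projection in \<open>A_mu\<close> leaves only the tangential part of the other
  factor visible. This turns the variational equation, written with \<open>grad_mu\<close>, into a
  statement about the distributional divergence, written with \<open>grad\<close>.\<close>

lemma inner_A_mu_grad_mu: "A_mu \<mu> A x \<xi> \<bullet> grad_mu \<mu> \<psi> x = A_mu \<mu> A x \<xi> \<bullet> grad \<psi> x"
  by (simp add: A_mu_def grad_mu_def inner_Pimu_Pimu)

lemma borel_measurable_A_mu:
  assumes M: "(\<lambda>x. x) \<in> borel_measurable M"
    and "A \<in> borel_measurable M" "h \<in> borel_measurable M"
  shows "(\<lambda>x. A_mu \<mu> A x (h x)) \<in> borel_measurable M"
proof -
  have "continuous_on UNIV (\<lambda>p::(real^'n^'n) \<times> (real^'n). fst p *v snd p)"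
    unfolding matrix_vector_mult_def by (intro continuous_intros)
  then have "(\<lambda>x. A x *v Pimu \<mu> x (h x)) \<in> borel_measurable M"
    by (rule borel_measurable_continuous_Pair[OF assms(2) borel_measurable_Pimu[OF M assms(3)]])
  from borel_measurable_Pimu[OF M this] show ?thesis
    unfolding A_mu_def .
qed

subsection \<open>The Euler equation\<close>

lemma integrable_inner_L2:
  fixes p q :: "'a \<Rightarrow> 'b::euclidean_space"
  assumes [measurable]: "p \<in> borel_measurable M" "q \<in> borel_measurable M"
    and "integrable M (\<lambda>x. (norm (p x))\<^sup>2)" "integrable M (\<lambda>x. (norm (q x))\<^sup>2)"
  shows "integrable M (\<lambda>x. p x \<bullet> q x)"
proof (rule Bochner_Integration.integrable_bound)
  show "integrable M (\<lambda>x. (norm (p x))\<^sup>2 + (norm (q x))\<^sup>2)"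
    using assms by (intro Bochner_Integration.integrable_add)
  have "\<bar>p x \<bullet> q x\<bar> \<le> (norm (p x))\<^sup>2 + (norm (q x))\<^sup>2" for x
  proof -
    have "2 * (norm (p x) * norm (q x)) \<le> (norm (p x))\<^sup>2 + (norm (q x))\<^sup>2"
      using sum_squares_bound[of "norm (p x)" "norm (q x)"] by simp
    moreover have "0 \<le> norm (p x) * norm (q x)" by simp
    ultimately show ?thesis using Cauchy_Schwarz_ineq2[of "p x" "q x"] by linarith
  qed
  then show "AE x in M. norm (p x \<bullet> q x) \<le> norm ((norm (p x))\<^sup>2 + (norm (q x))\<^sup>2)"
    by simp
qed measurable

lemma (in finite_measure) integrable_L2_imp_L1:
  fixes p :: "'a \<Rightarrow> 'b::euclidean_space"
  assumes [measurable]: "p \<in> borel_measurable M" and "integrable M (\<lambda>x. (norm (p x))\<^sup>2)"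
  shows "integrable M p"
proof (rule Bochner_Integration.integrable_bound)
  show "integrable M (\<lambda>x. 1 + (norm (p x))\<^sup>2)"
    using assms by (intro Bochner_Integration.integrable_add integrable_const)
  have "norm (p x) \<le> 1 + (norm (p x))\<^sup>2" for x
    using sum_squares_bound[of 1 "norm (p x)"] norm_ge_zero[of "p x"] unfolding power_one by linarith
  then show "AE x in M. norm (p x) \<le> norm (1 + (norm (p x))\<^sup>2)" by simp
qed measurable

lemma (in finite_measure) integrable_norm_square_bounded:
  fixes p :: "'a \<Rightarrow> 'b::euclidean_space"
  assumes [measurable]: "p \<in> borel_measurable M" and "\<And>x. norm (p x) \<le> C"
  shows "integrable M (\<lambda>x. (norm (p x))\<^sup>2)"
proof (rule integrable_const_bound)
  show "AE x in M. norm ((norm (p x))\<^sup>2) \<le> C\<^sup>2"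
    using assms(2) by (intro AE_I2) (auto intro!: power_mono)
qed measurable

lemma continuous_on_grad: "Ck 1 \<phi> \<Longrightarrow> continuous_on S (grad \<phi>)"
  unfolding grad_def[abs_def]
  by (intro continuous_on_vec_lambda) (auto intro: continuous_on_subset)

lemma Ck_1_Cc_inf: "\<psi> \<in> Cc_inf \<Longrightarrow> Ck 1 \<psi>"
  by (simp only: Cc_inf_def smooth_def mem_Collect_eq)

lemma continuous_on_Cc_inf: "\<psi> \<in> Cc_inf \<Longrightarrow> continuous_on S \<psi>"
  using Ck_1_Cc_inf Ck_continuous by blast

lemma bounded_of_continuous_compact_tsupport:
  assumes c: "continuous_on UNIV f" and "compact K" and "\<And>x. x \<notin> K \<Longrightarrow> f x = 0"
  shows "\<exists>C. \<forall>x. norm (f x) \<le> C"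
proof -
  have "bounded (f ` K)"
    using assms by (intro compact_imp_bounded compact_continuous_image) (auto intro: continuous_on_subset)
  then obtain C where "\<And>x. x \<in> K \<Longrightarrow> norm (f x) \<le> C" by (auto simp: bounded_iff)
  then have "norm (f x) \<le> max C 0" for x
    using assms(3)[of x] by (cases "x \<in> K") (auto simp: le_max_iff_disj)
  then show ?thesis by blast
qed

lemma bounded_Cc_inf: "\<psi> \<in> Cc_inf \<Longrightarrow> \<exists>C. \<forall>x. norm (\<psi> x) \<le> C"
  by (rule bounded_of_continuous_compact_tsupport[of _ "tsupport \<psi>"])
    (auto simp: continuous_on_Cc_inf Cc_inf_def tsupport_def intro: subsetD[OF closure_subset])

lemma bounded_grad_Cc_inf:
  assumes "\<psi> \<in> Cc_inf"
  shows "\<exists>C. \<forall>x. norm (grad \<psi> x) \<le> C"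
proof (rule bounded_of_continuous_compact_tsupport[of _ "tsupport \<psi>"])
  show "continuous_on UNIV (grad \<psi>)" by (rule continuous_on_grad[OF Ck_1_Cc_inf[OF assms]])
  show "compact (tsupport \<psi>)" using assms by (simp add: Cc_inf_def)
  fix x assume x: "x \<notin> tsupport \<psi>"
  have "(\<psi> has_derivative (\<lambda>v. 0)) (at x)"
  proof (rule has_derivative_transform_within_open[of "\<lambda>_. 0" _ _ _ "- tsupport \<psi>"])
    show "open (- tsupport \<psi>)" by (simp add: tsupport_def open_Compl)
    show "0 = \<psi> y" if "y \<in> - tsupport \<psi>" for y
      using that subsetD[OF closure_subset, of y "{x. \<psi> x \<noteq> 0}"] by (auto simp: tsupport_def)
  qed (use x in auto)
  then show "grad \<psi> x = 0"
    by (simp add: grad_def vec_eq_iff frechet_derivative_at[symmetric])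
qed

lemma borel_measurable_compose_id:
  assumes "(\<lambda>x. x) \<in> borel_measurable M" and "continuous_on UNIV h"
  shows "h \<in> borel_measurable M"
  using measurable_compose[OF assms(1) borel_measurable_continuous_onI[OF assms(2)]] by simp

lemma borel_measurable_grad_mu:
  assumes "(\<lambda>x. x) \<in> borel_measurable M" and "Ck 1 \<psi>"
  shows "grad_mu \<mu> \<psi> \<in> borel_measurable M"
  unfolding grad_mu_def[abs_def]
  by (intro borel_measurable_Pimu borel_measurable_compose_id[OF assms(1)] assms(1)
      continuous_on_grad assms(2))

lemma grad_mu_add:
  "f \<in> Cc_inf \<Longrightarrow> g \<in> Cc_inf \<Longrightarrow> grad_mu \<mu> (\<lambda>y. f y + g y) x = grad_mu \<mu> f x + grad_mu \<mu> g x"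
  by (simp add: grad_mu_def grad_add linear_add[OF linear_Pimu])

lemma grad_mu_scaleR:
  "f \<in> Cc_inf \<Longrightarrow> grad_mu \<mu> (\<lambda>y. c *\<^sub>R f y) x = c *\<^sub>R grad_mu \<mu> f x"
  unfolding grad_mu_def grad_scaleR by (rule linear_scale[OF linear_Pimu])

lemma Cc_inf_L2:
  assumes "finite_measure (completion \<mu>)" and id: "(\<lambda>x. x) \<in> borel_measurable (completion \<mu>)"
    and \<psi>: "\<psi> \<in> Cc_inf"
  shows "\<psi> \<in> borel_measurable (completion \<mu>)"
    and "grad_mu \<mu> \<psi> \<in> borel_measurable (completion \<mu>)"
    and "integrable (completion \<mu>) (\<lambda>x. (norm (\<psi> x))\<^sup>2)"
    and "integrable (completion \<mu>) (\<lambda>x. (norm (grad_mu \<mu> \<psi> x))\<^sup>2)"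
proof -
  interpret M: finite_measure "completion \<mu>" by fact
  show m: "\<psi> \<in> borel_measurable (completion \<mu>)" "grad_mu \<mu> \<psi> \<in> borel_measurable (completion \<mu>)"
    by (intro borel_measurable_compose_id[OF id] continuous_on_Cc_inf borel_measurable_grad_mu[OF id] Ck_1_Cc_inf \<psi>)+
  show "integrable (completion \<mu>) (\<lambda>x. (norm (\<psi> x))\<^sup>2)"
    using bounded_Cc_inf[OF \<psi>] M.integrable_norm_square_bounded[OF m(1)] by blast
  show "integrable (completion \<mu>) (\<lambda>x. (norm (grad_mu \<mu> \<psi> x))\<^sup>2)"
    using bounded_grad_Cc_inf[OF \<psi>] norm_Pimu_le M.integrable_norm_square_bounded[OF m(2)]
    unfolding grad_mu_def by (meson order_trans)
qed

lemma integrable_norm_square_add: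
  fixes p q :: "'a \<Rightarrow> 'b::euclidean_space"
  assumes [measurable]: "p \<in> borel_measurable M" "q \<in> borel_measurable M"
    and "integrable M (\<lambda>x. (norm (p x))\<^sup>2)" "integrable M (\<lambda>x. (norm (q x))\<^sup>2)"
  shows "integrable M (\<lambda>x. (norm (p x + q x))\<^sup>2)"
proof -
  have "(norm (p x + q x))\<^sup>2 = (norm (p x))\<^sup>2 + 2 * (p x \<bullet> q x) + (norm (q x))\<^sup>2" for x
    by (simp add: power2_norm_eq_inner inner_add_left inner_add_right inner_commute)
  then show ?thesis
    using assms integrable_inner_L2[of p M q] by simp
qed

text \<open>Adding \<open>\<psi>\<close> to each member of an approximating sequence leaves all the
  differences unchanged.\<close>

lemma H12_add_Cc_inf:
  assumes fin: "finite_measure (completion \<mu>)" and id: "(\<lambda>x. x) \<in> borel_measurable (completion \<mu>)"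
    and ug: "(u, g) \<in> H12 \<mu>" and \<psi>: "\<psi> \<in> Cc_inf"
  shows "(\<lambda>x. u x + \<psi> x, \<lambda>x. g x + grad_mu \<mu> \<psi> x) \<in> H12 \<mu>"
proof -
  note L2 = Cc_inf_L2[OF fin id \<psi>]
  obtain v where v: "\<And>n. v n \<in> Cc_inf"
    "(\<lambda>n. \<integral>\<^sup>+ x. ennreal ((v n x - u x)\<^sup>2) \<partial>completion \<mu>) \<longlonglongrightarrow> 0"
    "(\<lambda>n. \<integral>\<^sup>+ x. ennreal ((norm (grad_mu \<mu> (v n) x - g x))\<^sup>2) \<partial>completion \<mu>) \<longlonglongrightarrow> 0"
    and ug': "u \<in> borel_measurable (completion \<mu>)" "g \<in> borel_measurable (completion \<mu>)"
    "integrable (completion \<mu>) (\<lambda>x. (u x)\<^sup>2)" "integrable (completion \<mu>) (\<lambda>x. (norm (g x))\<^sup>2)"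
    using ug unfolding H12_def by blast
  have "integrable (completion \<mu>) (\<lambda>x. (u x + \<psi> x)\<^sup>2)"
    using integrable_norm_square_add[OF ug'(1) L2(1)] ug'(3) L2(3) by simp
  moreover have "integrable (completion \<mu>) (\<lambda>x. (norm (g x + grad_mu \<mu> \<psi> x))\<^sup>2)"
    by (rule integrable_norm_square_add[OF ug'(2) L2(2) ug'(4) L2(4)])
  moreover have "\<exists>w :: nat \<Rightarrow> real^'a \<Rightarrow> real. (\<forall>n. w n \<in> Cc_inf) \<and>
         ((\<lambda>n. \<integral>\<^sup>+ x. ennreal ((w n x - (u x + \<psi> x))\<^sup>2) \<partial>completion \<mu>) \<longlonglongrightarrow> 0) \<and>
         ((\<lambda>n. \<integral>\<^sup>+ x. ennreal ((norm (grad_mu \<mu> (w n) x - (g x + grad_mu \<mu> \<psi> x)))\<^sup>2) \<partial>completion \<mu>) \<longlonglongrightarrow> 0)"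
    using v by (intro exI[of _ "\<lambda>n x. v n x + \<psi> x"]) (simp add: Cc_inf_add \<psi> grad_mu_add)
  ultimately show ?thesis
    unfolding H12_def using ug'(1,2) L2(1,2) by simp
qed

lemma linear_coeff_eq_0_of_quadratic_nonneg:
  fixes L Q :: real
  assumes "\<And>t. 0 \<le> t * L + t\<^sup>2 * Q"
  shows "L = 0"
proof (rule ccontr)
  assume "L \<noteq> 0"
  \<comment> \<open>The quadratic is negative for small \<open>t\<close> of sign opposite to
    \<open>L\<close>. The denominator dominates \<open>Q\<close> of either sign and is never
    0.\<close>
  define t where "t = - L / (\<bar>Q\<bar> + 1)"
  have "\<bar>Q\<bar> + 1 > 0" by simp
  then have "t * L + t\<^sup>2 * Q = L\<^sup>2 * (Q - (\<bar>Q\<bar> + 1)) / (\<bar>Q\<bar> + 1)\<^sup>2"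
    by (simp add: t_def power2_eq_square divide_simps) (simp add: algebra_simps)
  moreover have "L\<^sup>2 * (Q - (\<bar>Q\<bar> + 1)) < 0"
    using \<open>L \<noteq> 0\<close> by (intro mult_pos_neg) auto
  ultimately have "t * L + t\<^sup>2 * Q < 0"
    using \<open>\<bar>Q\<bar> + 1 > 0\<close> by (simp add: divide_neg_pos)
  with assms[of t] show False by simp
qed

lemma A_mu_L2:
  assumes id: "(\<lambda>x. x) \<in> borel_measurable M" and A: "A \<in> borel_measurable M"
    and C: "AE x in M. norm (A x) \<le> C"
    and p: "p \<in> borel_measurable M" "integrable M (\<lambda>x. (norm (p x))\<^sup>2)"
  shows "(\<lambda>x. A_mu \<mu> A x (p x)) \<in> borel_measurable M"
    and "integrable M (\<lambda>x. (norm (A_mu \<mu> A x (p x)))\<^sup>2)"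
proof -
  show [measurable]: "(\<lambda>x. A_mu \<mu> A x (p x)) \<in> borel_measurable M"
    by (rule borel_measurable_A_mu[OF id A p(1)])
  show "integrable M (\<lambda>x. (norm (A_mu \<mu> A x (p x)))\<^sup>2)"
  proof (rule Bochner_Integration.integrable_bound)
    show "integrable M (\<lambda>x. C\<^sup>2 * (norm (p x))\<^sup>2)" using p(2) by simp
    show "AE x in M. norm ((norm (A_mu \<mu> A x (p x)))\<^sup>2) \<le> norm (C\<^sup>2 * (norm (p x))\<^sup>2)"
      using C
    proof eventually_elim
      case (elim x)
      have "norm (A_mu \<mu> A x (p x)) \<le> C * norm (p x)"
        using norm_A_mu_le[of \<mu> A x "p x"] mult_right_mono[OF elim norm_ge_zero[of "p x"]] by simp
      then have "(norm (A_mu \<mu> A x (p x)))\<^sup>2 \<le> (C * norm (p x))\<^sup>2" by (intro power_mono) auto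
      then show ?case by (simp add: power_mult_distrib)
    qed
  qed measurable
qed

lemma set_integrable_inner_L2:
  fixes p q :: "'a \<Rightarrow> 'b::euclidean_space"
  assumes "\<Omega> \<in> sets M" "p \<in> borel_measurable M" "q \<in> borel_measurable M"
    and "integrable M (\<lambda>x. (norm (p x))\<^sup>2)" "integrable M (\<lambda>x. (norm (q x))\<^sup>2)"
  shows "set_integrable M \<Omega> (\<lambda>x. p x \<bullet> q x)"
  unfolding set_integrable_def
  by (rule integrable_mult_indicator[OF assms(1) integrable_inner_L2]) (use assms in auto)

lemma Euler_Lagrange_Cc_inf:
  assumes fin: "finite_measure (completion \<mu>)" and id: "(\<lambda>x. x) \<in> borel_measurable (completion \<mu>)"
    and \<Omega>: "\<Omega> \<in> sets (completion \<mu>)"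
    and f: "f \<in> borel_measurable (completion \<mu>)" "integrable (completion \<mu>) (\<lambda>x. (f x)\<^sup>2)"
    and A: "A \<in> borel_measurable (completion \<mu>)" "AE x in completion \<mu>. norm (A x) \<le> C"
      "AE x in completion \<mu>. transpose (A x) = A x"
    and ug: "(u, g) \<in> H12 \<mu>"
    and min: "\<And>v h. (v, h) \<in> H12 \<mu> \<Longrightarrow> energy \<mu> \<Omega> A f (u, g) \<le> energy \<mu> \<Omega> A f (v, h)"
    and \<psi>: "\<psi> \<in> Cc_inf"
  shows "(\<integral>x\<in>\<Omega>. A_mu \<mu> A x (g x) \<bullet> grad \<psi> x \<partial>completion \<mu>) = (\<integral>x\<in>\<Omega>. f x * \<psi> x \<partial>completion \<mu>)"
proof -
  let ?M = "completion \<mu>" and ?q = "grad_mu \<mu> \<psi>"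
  note q = Cc_inf_L2[OF fin id \<psi>]
  have ug': "u \<in> borel_measurable ?M" "g \<in> borel_measurable ?M"
    "integrable ?M (\<lambda>x. (u x)\<^sup>2)" "integrable ?M (\<lambda>x. (norm (g x))\<^sup>2)"
    using ug unfolding H12_def by blast+
  note Ag = A_mu_L2[OF id A(1,2) ug'(2,4), of \<mu>]
  note Aq = A_mu_L2[OF id A(1,2) q(2,4), of \<mu>]
  let ?a = "\<lambda>x. A_mu \<mu> A x (g x) \<bullet> g x" and ?b = "\<lambda>x. A_mu \<mu> A x (g x) \<bullet> ?q x"
    and ?c = "\<lambda>x. A_mu \<mu> A x (?q x) \<bullet> ?q x"
  have i: "set_integrable ?M \<Omega> ?a" "set_integrable ?M \<Omega> ?b" "set_integrable ?M \<Omega> ?c"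
    by (intro set_integrable_inner_L2 \<Omega> ug' q Ag Aq)+
  have fi: "set_integrable ?M \<Omega> (\<lambda>x. f x * u x)" "set_integrable ?M \<Omega> (\<lambda>x. f x * \<psi> x)"
    using set_integrable_inner_L2[OF \<Omega> f(1) ug'(1)] set_integrable_inner_L2[OF \<Omega> f(1) q(1)] f(2) ug'(3) q(3)
    by simp_all
  \<comment> \<open>\<open>L\<close> and \<open>Q\<close> are the coefficients of \<open>t\<close>
    and \<open>t\<^sup>2\<close> in the energy at the perturbation by \<open>t * \<psi>\<close>; the
    factor 1/2 of the energy cancels the 2 of the cross term.\<close>
  define L where "L = (\<integral>x\<in>\<Omega>. ?b x \<partial>?M) - (\<integral>x\<in>\<Omega>. f x * \<psi> x \<partial>?M)"
  define Q where "Q = (1/2) * (\<integral>x\<in>\<Omega>. ?c x \<partial>?M)"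
  have "0 \<le> t * L + t\<^sup>2 * Q" for t
  proof -
    have t\<psi>: "(\<lambda>x. t *\<^sub>R \<psi> x) \<in> Cc_inf" by (rule Cc_inf_scaleR[OF \<psi>])
    have H: "(\<lambda>x. u x + t * \<psi> x, \<lambda>x. g x + t *\<^sub>R ?q x) \<in> H12 \<mu>"
      using H12_add_Cc_inf[OF fin id ug t\<psi>] unfolding grad_mu_scaleR[OF \<psi>] by simp
    have "(\<integral>x\<in>\<Omega>. A_mu \<mu> A x (g x + t *\<^sub>R ?q x) \<bullet> (g x + t *\<^sub>R ?q x) \<partial>?M)
        = (\<integral>x\<in>\<Omega>. ?a x + ((2 * t) * ?b x + t\<^sup>2 * ?c x) \<partial>?M)"
    proof (rule set_lebesgue_integral_cong_AE[OF \<Omega>])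
      have gq: "(\<lambda>x. g x + t *\<^sub>R ?q x) \<in> borel_measurable ?M"
        using ug'(2) q(2) by measurable
      show "(\<lambda>x. A_mu \<mu> A x (g x + t *\<^sub>R ?q x) \<bullet> (g x + t *\<^sub>R ?q x)) \<in> borel_measurable ?M"
        using gq borel_measurable_A_mu[OF id A(1) gq, of \<mu>] by (rule borel_measurable_inner[rotated])
      show "(\<lambda>x. ?a x + ((2 * t) * ?b x + t\<^sup>2 * ?c x)) \<in> borel_measurable ?M"
        using Ag(1) Aq(1) ug'(2) q(2) by measurable
      show "AE x\<in>\<Omega> in ?M. A_mu \<mu> A x (g x + t *\<^sub>R ?q x) \<bullet> (g x + t *\<^sub>R ?q x)
          = ?a x + ((2 * t) * ?b x + t\<^sup>2 * ?c x)"
        using A(3)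
      proof eventually_elim
        case (elim x)
        \<comment> \<open>Symmetry of \<open>A x\<close> merges the two cross terms. It holds only
          almost everywhere, hence the almost everywhere form of the congruence.\<close>
        have "A_mu \<mu> A x (?q x) \<bullet> g x = ?b x" by (rule inner_A_mu_commute[of A x, OF elim])
        then show ?case
          by (simp add: linear_add[OF linear_A_mu] linear_scale[OF linear_A_mu] inner_add_left inner_add_right
              power2_eq_square algebra_simps)
      qed
    qed
    also have "\<dots> = (\<integral>x\<in>\<Omega>. ?a x \<partial>?M) + ((2 * t) * (\<integral>x\<in>\<Omega>. ?b x \<partial>?M) + t\<^sup>2 * (\<integral>x\<in>\<Omega>. ?c x \<partial>?M))"
      using i by (simp add: set_integral_add(2))
    finally have 1: "(\<integral>x\<in>\<Omega>. A_mu \<mu> A x (g x + t *\<^sub>R ?q x) \<bullet> (g x + t *\<^sub>R ?q x) \<partial>?M) = \<dots>" .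
    have "(\<integral>x\<in>\<Omega>. f x * (u x + t * \<psi> x) \<partial>?M) = (\<integral>x\<in>\<Omega>. f x * u x + t * (f x * \<psi> x) \<partial>?M)"
      by (simp add: algebra_simps)
    also have "\<dots> = (\<integral>x\<in>\<Omega>. f x * u x \<partial>?M) + t * (\<integral>x\<in>\<Omega>. f x * \<psi> x \<partial>?M)"
      using fi by (simp add: set_integral_add(2))
    finally have 2: "(\<integral>x\<in>\<Omega>. f x * (u x + t * \<psi> x) \<partial>?M) = \<dots>" .
    have "energy \<mu> \<Omega> A f (\<lambda>x. u x + t * \<psi> x, \<lambda>x. g x + t *\<^sub>R ?q x) = energy \<mu> \<Omega> A f (u, g) + (t * L + t\<^sup>2 * Q)"
      unfolding energy_def fst_conv snd_conv 1 2 L_def Q_def by (simp add: algebra_simps)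
    with min[OF H] show ?thesis by simp
  qed
  then have "L = 0" by (rule linear_coeff_eq_0_of_quadratic_nonneg)
  then show ?thesis unfolding L_def inner_A_mu_grad_mu by simp
qed

text \<open>The inner product form covers both \<open>p x \<bullet> grad h x\<close> and, over the
  reals, \<open>f x * h x\<close>.\<close>

lemma set_integrable_inner_bounded:
  fixes p h :: "'a \<Rightarrow> 'b::euclidean_space"
  assumes "\<Omega> \<in> sets M" "integrable M p" "h \<in> borel_measurable M" "\<And>x. x \<in> \<Omega> \<Longrightarrow> norm (h x) \<le> C"
  shows "set_integrable M \<Omega> (\<lambda>x. p x \<bullet> h x)"
    and "\<bar>\<integral>x\<in>\<Omega>. p x \<bullet> h x \<partial>M\<bar> \<le> C * (\<integral>x\<in>\<Omega>. norm (p x) \<partial>M)"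
proof -
  have [measurable]: "p \<in> borel_measurable M" "h \<in> borel_measurable M" "\<Omega> \<in> sets M" using assms by auto
  have n: "set_integrable M \<Omega> (\<lambda>x. C * norm (p x))"
    unfolding set_integrable_def
    by (rule integrable_mult_indicator[OF assms(1)]) (simp add: assms(2))
  have bd: "\<bar>p x \<bullet> h x\<bar> \<le> C * norm (p x)" if "x \<in> \<Omega>" for x
  proof -
    have "norm (p x) * norm (h x) \<le> norm (p x) * C" using assms(4)[OF that] by (intro mult_left_mono) auto
    then show ?thesis using Cauchy_Schwarz_ineq2[of "p x" "h x"] by (simp add: mult.commute)
  qed
  show i: "set_integrable M \<Omega> (\<lambda>x. p x \<bullet> h x)"
  proof (rule set_integrable_bound[OF n])
    show "set_borel_measurable M \<Omega> (\<lambda>x. p x \<bullet> h x)" unfolding set_borel_measurable_def by measurable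
    show "AE x in M. x \<in> \<Omega> \<longrightarrow> norm (p x \<bullet> h x) \<le> norm (C * norm (p x))"
      using bd by (intro AE_I2) (force simp: abs_le_iff)
  qed
  have "\<bar>\<integral>x\<in>\<Omega>. p x \<bullet> h x \<partial>M\<bar> \<le> (\<integral>x. norm (indicator \<Omega> x *\<^sub>R (p x \<bullet> h x)) \<partial>M)"
    unfolding set_lebesgue_integral_def
    using integral_norm_bound[of M "\<lambda>x. indicator \<Omega> x *\<^sub>R (p x \<bullet> h x)"] by simp
  also have "\<dots> = (\<integral>x\<in>\<Omega>. \<bar>p x \<bullet> h x\<bar> \<partial>M)"
    unfolding set_lebesgue_integral_def by (simp add: abs_mult)
  also have "\<dots> \<le> (\<integral>x\<in>\<Omega>. C * norm (p x) \<partial>M)"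
    by (rule set_integral_mono[OF set_integrable_abs[OF i] n bd])
  also have "\<dots> = C * (\<integral>x\<in>\<Omega>. norm (p x) \<partial>M)" by simp
  finally show "\<bar>\<integral>x\<in>\<Omega>. p x \<bullet> h x \<partial>M\<bar> \<le> C * (\<integral>x\<in>\<Omega>. norm (p x) \<partial>M)" .
qed

lemma bounded_on_bounded_set:
  fixes h :: "'a::euclidean_space \<Rightarrow> 'b::real_normed_vector"
  assumes "continuous_on UNIV h" "bounded \<Omega>"
  obtains C where "\<And>x. x \<in> \<Omega> \<Longrightarrow> norm (h x) \<le> C"
proof -
  have "bounded (h ` closure \<Omega>)"
    using assms by (intro compact_imp_bounded compact_continuous_image) (auto intro: continuous_on_subset)
  then show thesis using that closure_subset by (fastforce simp: bounded_iff)
qed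

lemma weak_equation_extends_to_C1:
  fixes p :: "real^'n \<Rightarrow> real^'n"
  assumes \<Omega>: "\<Omega> \<in> sets M" "bounded \<Omega>" and id: "(\<lambda>x. x) \<in> borel_measurable M"
    and p: "integrable M p" and f: "integrable M f"
    and eq: "\<And>\<psi>. \<psi> \<in> Cc_inf \<Longrightarrow> (\<integral>x\<in>\<Omega>. p x \<bullet> grad \<psi> x \<partial>M) = (\<integral>x\<in>\<Omega>. f x * \<psi> x \<partial>M)"
    and \<phi>: "Ck 1 \<phi>"
  shows "(\<integral>x\<in>\<Omega>. p x \<bullet> grad \<phi> x \<partial>M) = (\<integral>x\<in>\<Omega>. f x * \<phi> x \<partial>M)"
proof -
  have cont: "continuous_on UNIV (grad h)" "continuous_on UNIV h" if "Ck 1 h" for h :: "real^'n \<Rightarrow> real"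
    using continuous_on_grad[OF that] Ck_continuous[OF that] by blast+
  have int: "set_integrable M \<Omega> (\<lambda>x. p x \<bullet> grad h x)" "set_integrable M \<Omega> (\<lambda>x. f x * h x)"
    if h: "Ck 1 h" for h
  proof -
    obtain C where "\<And>x. x \<in> \<Omega> \<Longrightarrow> norm (grad h x) \<le> C"
      using bounded_on_bounded_set[OF cont(1)[OF h] \<Omega>(2)] by blast
    then show "set_integrable M \<Omega> (\<lambda>x. p x \<bullet> grad h x)"
      by (rule set_integrable_inner_bounded(1)[OF \<Omega>(1) p borel_measurable_compose_id[OF id cont(1)[OF h]]])
    obtain C where "\<And>x. x \<in> \<Omega> \<Longrightarrow> norm (h x) \<le> C"
      using bounded_on_bounded_set[OF cont(2)[OF h] \<Omega>(2)] by blast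
    from set_integrable_inner_bounded(1)[OF \<Omega>(1) f borel_measurable_compose_id[OF id cont(2)[OF h]] this]
    show "set_integrable M \<Omega> (\<lambda>x. f x * h x)"
      by simp
  qed
  let ?D = "(\<integral>x\<in>\<Omega>. p x \<bullet> grad \<phi> x \<partial>M) - (\<integral>x\<in>\<Omega>. f x * \<phi> x \<partial>M)"
  \<comment> \<open>Both errors of replacing \<open>\<phi>\<close> by \<open>\<psi>\<close> are at
    most \<open>\<epsilon>\<close> times an integral of a norm over \<open>\<Omega>\<close>;
    \<open>K\<close> adds the two. Below, division by \<open>K + 1\<close> covers the case
    \<open>K = 0\<close>.\<close>
  define K where "K = (\<integral>x\<in>\<Omega>. norm (p x) \<partial>M) + (\<integral>x\<in>\<Omega>. norm (f x) \<partial>M)"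
  have K0: "K \<ge> 0" unfolding K_def set_lebesgue_integral_def by (intro add_nonneg_nonneg integral_nonneg_AE AE_I2) auto
  have D: "\<bar>?D\<bar> \<le> \<epsilon> * K" if \<epsilon>: "\<epsilon> > 0" for \<epsilon>
  proof -
    obtain \<psi> where \<psi>: "\<psi> \<in> Cc_inf" "\<And>x. x \<in> \<Omega> \<Longrightarrow> \<bar>\<psi> x - \<phi> x\<bar> \<le> \<epsilon>"
        "\<And>x. x \<in> \<Omega> \<Longrightarrow> norm (grad \<psi> x - grad \<phi> x) \<le> \<epsilon>"
      using Cc_inf_C1_dense[OF \<phi> \<Omega>(2) \<epsilon>] by blast
    note c\<psi> = Ck_1_Cc_inf[OF \<psi>(1)]
    have "(\<integral>x\<in>\<Omega>. p x \<bullet> (grad \<psi> x - grad \<phi> x) \<partial>M) = (\<integral>x\<in>\<Omega>. p x \<bullet> grad \<psi> x \<partial>M) - (\<integral>x\<in>\<Omega>. p x \<bullet> grad \<phi> x \<partial>M)"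
      using int(1)[OF c\<psi>] int(1)[OF \<phi>] by (simp add: inner_diff_right set_integral_diff(2))
    moreover have "\<bar>\<integral>x\<in>\<Omega>. p x \<bullet> (grad \<psi> x - grad \<phi> x) \<partial>M\<bar> \<le> \<epsilon> * (\<integral>x\<in>\<Omega>. norm (p x) \<partial>M)"
      by (rule set_integrable_inner_bounded(2)[OF \<Omega>(1) p borel_measurable_compose_id[OF id] \<psi>(3)])
        (intro continuous_on_diff cont c\<psi> \<phi>)
    moreover have "(\<integral>x\<in>\<Omega>. f x * (\<psi> x - \<phi> x) \<partial>M) = (\<integral>x\<in>\<Omega>. f x * \<psi> x \<partial>M) - (\<integral>x\<in>\<Omega>. f x * \<phi> x \<partial>M)"
      using int(2)[OF c\<psi>] int(2)[OF \<phi>] by (simp add: right_diff_distrib set_integral_diff(2))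
    moreover have "\<bar>\<integral>x\<in>\<Omega>. f x * (\<psi> x - \<phi> x) \<partial>M\<bar> \<le> \<epsilon> * (\<integral>x\<in>\<Omega>. norm (f x) \<partial>M)"
      using set_integrable_inner_bounded(2)[OF \<Omega>(1) f borel_measurable_compose_id[OF id], of "\<lambda>x. \<psi> x - \<phi> x" \<epsilon>]
        continuous_on_diff[OF cont(2)[OF c\<psi>] cont(2)[OF \<phi>]] \<psi>(2) by simp
    ultimately show ?thesis
      using eq[OF \<psi>(1)] unfolding K_def distrib_left by linarith
  qed
  have "\<bar>?D\<bar> \<le> 0"
  proof (rule field_le_epsilon)
    fix e :: real assume "e > 0"
    have "\<bar>?D\<bar> \<le> e / (K + 1) * K" using K0 \<open>e > 0\<close> by (intro D) auto
    also have "\<dots> \<le> 0 + e" using K0 \<open>e > 0\<close> by (simp add: field_simps)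
    finally show "\<bar>?D\<bar> \<le> 0 + e" .
  qed
  then show ?thesis by simp
qed

section \<open>The divergence as a difference of two finite measures\<close>

lemma finite_measure_density:
  fixes h :: "'a \<Rightarrow> real"
  assumes "integrable M h" "\<And>x. h x \<ge> 0"
  shows "finite_measure (density M (\<lambda>x. ennreal (h x)))"
proof
  have "emeasure (density M (\<lambda>x. ennreal (h x))) (space M) = (\<integral>\<^sup>+x. ennreal (h x) \<partial>M)"
    using assms(1) by (subst emeasure_density) (auto intro!: nn_integral_cong)
  also have "\<dots> = ennreal (\<integral>x. h x \<partial>M)"
    using assms by (intro nn_integral_eq_integral) auto
  finally show "emeasure (density M (\<lambda>x. ennreal (h x))) (space (density M (\<lambda>x. ennreal (h x)))) \<noteq> \<infinity>"
    by simp
qed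

text \<open>\<open>Dp\<close> and \<open>Dm\<close> are the positive and negative parts of the
  signed measure with density -f on \<open>\<Omega>\<close>. They are Borel measures, while
  \<open>f\<close> is measurable only for the completion.\<close>

lemma signed_density:
  fixes \<mu> :: "'a::euclidean_space measure" and f :: "'a \<Rightarrow> real"
  assumes sets: "sets \<mu> = sets borel" and \<Omega>: "open \<Omega>" "bounded \<Omega>" and f: "integrable (completion \<mu>) f"
  obtains Dp Dm :: "'a measure" where "sets Dp = sets borel" "sets Dm = sets borel"
    "finite_measure Dp" "finite_measure Dm" "emeasure Dp (UNIV - \<Omega>) = 0" "emeasure Dm (UNIV - \<Omega>) = 0"
    "\<And>\<phi>. continuous_on UNIV \<phi> \<Longrightarrow> (\<integral>x. \<phi> x \<partial>Dp) - (\<integral>x. \<phi> x \<partial>Dm) = - (\<integral>x\<in>\<Omega>. f x * \<phi> x \<partial>completion \<mu>)"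
proof -
  note [measurable_cong] = sets
  have \<Omega>b: "\<Omega> \<in> sets \<mu>" "UNIV - \<Omega> \<in> sets \<mu>" 
    using borel_open[OF \<Omega>(1)] borel_closed[OF closed_Diff[OF closed_UNIV \<Omega>(1)]] unfolding sets .
  \<comment> \<open>A Borel representative is needed because the densities are taken with respect to
    \<open>\<mu>\<close>; integrals over the completion do not notice the change.\<close>
  obtain f' where f' [measurable]: "f' \<in> borel_measurable \<mu>" and ff': "AE x in \<mu>. f x = f' x"
    using completion_ex_borel_measurable_real[OF borel_measurable_integrable[OF f]] by blast
  have ae: "AE x in completion \<mu>. f x = f' x" using ff' by (rule AE_completion)
  define h where "h x = f' x * indicator \<Omega> x" for x
  have [measurable]: "h \<in> borel_measurable \<mu>" unfolding h_def using \<Omega>b by measurable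
  have "integrable (completion \<mu>) f'"
    using f integrable_cong_AE[OF borel_measurable_integrable[OF f] measurable_completion[OF f'] ae] by blast
  then have "integrable \<mu> f'" by (simp add: integrable_completion)
  then have h: "integrable \<mu> h"
    unfolding h_def using integrable_real_mult_indicator[OF \<Omega>b(1)] by blast
  have p: "integrable \<mu> (\<lambda>x. max 0 (- h x))" and m: "integrable \<mu> (\<lambda>x. max 0 (h x))"
    using h by (auto intro!: Bochner_Integration.integrable_max)
  \<comment> \<open>The sign \<open>s\<close> treats both parts at once: \<open>s = -1\<close>
    yields \<open>Dp\<close> and \<open>s = 1\<close> yields \<open>Dm\<close>, since the divergence
    carries a minus sign.\<close>
  let ?D = "\<lambda>s::real. density \<mu> (\<lambda>x. ennreal (max 0 (s * h x)))"
  have null: "emeasure (?D s) (UNIV - \<Omega>) = 0" for s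
    using \<Omega>b by (subst emeasure_density) (auto simp: h_def nn_integral_0_iff_AE split: split_indicator)
  show thesis
  proof (rule that[of "?D (-1)" "?D 1"])
    show "finite_measure (?D (-1))" "finite_measure (?D 1)"
      using finite_measure_density[OF p] finite_measure_density[OF m] by simp_all
    show "(\<integral>x. \<phi> x \<partial>?D (-1)) - (\<integral>x. \<phi> x \<partial>?D 1) = - (\<integral>x\<in>\<Omega>. f x * \<phi> x \<partial>completion \<mu>)"
      if \<phi>: "continuous_on UNIV \<phi>" for \<phi>
    proof -
      have [measurable]: "\<phi> \<in> borel_measurable \<mu>"
        using borel_measurable_continuous_onI[OF \<phi>] sets by (simp add: measurable_def sets_eq_imp_space_eq[OF sets])
      obtain C where C: "\<And>x. x \<in> \<Omega> \<Longrightarrow> norm (\<phi> x) \<le> C" using bounded_on_bounded_set[OF \<phi> \<Omega>(2)] by blast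
      have i: "integrable \<mu> (\<lambda>x. max 0 (s * h x) * \<phi> x)" for s
      proof (rule Bochner_Integration.integrable_bound)
        show "integrable \<mu> (\<lambda>x. C * (s * h x))" using h by simp
        have "norm (max 0 (s * h x) * \<phi> x) \<le> norm (C * (s * h x))" for x
        proof (cases "x \<in> \<Omega>")
          case True
          have "\<bar>max 0 (s * h x)\<bar> * \<bar>\<phi> x\<bar> \<le> \<bar>s * h x\<bar> * \<bar>C\<bar>"
            using C[OF True] by (intro mult_mono) auto
          then show ?thesis by (simp add: abs_mult mult_ac)
        qed (simp add: h_def)
        then show "AE x in \<mu>. norm (max 0 (s * h x) * \<phi> x) \<le> norm (C * (s * h x))" by simp
      qed measurable
      have I: "(\<integral>x. \<phi> x \<partial>?D s) = (\<integral>x. max 0 (s * h x) * \<phi> x \<partial>\<mu>)" for s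
        by (subst integral_density) auto
      have "(\<integral>x. \<phi> x \<partial>?D (-1)) - (\<integral>x. \<phi> x \<partial>?D 1)
          = (\<integral>x. max 0 ((-1) * h x) * \<phi> x \<partial>\<mu>) - (\<integral>x. max 0 (1 * h x) * \<phi> x \<partial>\<mu>)"
        by (simp only: I)
      also have "\<dots> = (\<integral>x. max 0 ((-1) * h x) * \<phi> x - max 0 (1 * h x) * \<phi> x \<partial>\<mu>)"
        using i by (intro Bochner_Integration.integral_diff[symmetric])
      also have "\<dots> = (\<integral>x. - (h x * \<phi> x) \<partial>\<mu>)"
        by (rule Bochner_Integration.integral_cong) (auto simp: max_def)
      also have "\<dots> = - (\<integral>x. h x * \<phi> x \<partial>completion \<mu>)"
        by (simp add: integral_completion)
      also have "(\<integral>x. h x * \<phi> x \<partial>completion \<mu>) = (\<integral>x\<in>\<Omega>. f x * \<phi> x \<partial>completion \<mu>)"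
        unfolding set_lebesgue_integral_def
      proof (rule integral_cong_AE)
        have [measurable]: "\<phi> \<in> borel_measurable (completion \<mu>)" "f \<in> borel_measurable (completion \<mu>)"
            "\<Omega> \<in> sets (completion \<mu>)"
          using f \<Omega>b by (auto intro: measurable_completion)
        show "(\<lambda>x. h x * \<phi> x) \<in> borel_measurable (completion \<mu>)"
          by (rule measurable_completion) measurable
        show "(\<lambda>x. indicator \<Omega> x *\<^sub>R (f x * \<phi> x)) \<in> borel_measurable (completion \<mu>)" by measurable
        show "AE x in completion \<mu>. h x * \<phi> x = indicator \<Omega> x *\<^sub>R (f x * \<phi> x)"
          using ae by eventually_elim (simp add: h_def)
      qed
      finally show ?thesis .
    qed
  qed (use null[of "-1"] null[of 1] sets in simp_all)
qed

text \<open>The finite signed measure div F is represented by the pair \<open>Dp\<close>,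
  \<open>Dm\<close>, and the same pair occurs in the distributional identity and in the trace
  identity. Functions in \<open>C\<^sup>2\<close> of the closed domain are represented by
  \<open>C\<^sup>2\<close> functions on the whole space.\<close>

theorem theorem4p3:
  fixes \<mu> :: "(real^'n) measure" and \<Omega> :: "(real^'n) set"
    and J :: nat and S :: "nat \<Rightarrow> (real^'n) set" and k :: "nat \<Rightarrow> nat"
    and A :: "real^'n \<Rightarrow> real^'n^'n" and lam :: real
    and f :: "real^'n \<Rightarrow> real"
    and u :: "real^'n \<Rightarrow> real" and g :: "real^'n \<Rightarrow> real^'n"
  \<comment> \<open>Condition [S]\<close>
  assumes \<Omega>: "smooth_bounded_domain \<Omega>"
    and mu_def: "\<mu> = measure_of UNIV (sets borel)
                      (\<lambda>X. \<Sum>j<J. emeasure (hausdorff_restr (k j) (S j)) X)"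
    and manif: "\<And>j. j < J \<Longrightarrow> C2_manifold (k j) (S j) \<and> k j < CARD('n)"
    and supp: "msupp \<mu> = (\<Union>j<J. S j)" and supp_sub: "(\<Union>j<J. S j) \<subseteq> closure \<Omega>"
    and disj: "\<And>i j. i < J \<Longrightarrow> j < J \<Longrightarrow> i \<noteq> j \<Longrightarrow>
                  emeasure (hausdorff_restr (k j) (S j)) (S i) = 0"
    and bdry: "\<And>i. i < J \<Longrightarrow> mbdry (k i) (S i) \<subseteq> frontier \<Omega> \<union> (\<Union>j\<in>{j. j < J \<and> j \<noteq> i}. closure (S j))"
    and rint: "\<And>i. i < J \<Longrightarrow> minterior (k i) (S i) \<inter> frontier \<Omega> = {}"
  \<comment> \<open>Condition (Q)\<close>
    and f_meas: "f \<in> borel_measurable (completion \<mu>)"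
    and f_L2: "integrable (completion \<mu>) (\<lambda>x. (f x)\<^sup>2)"
    and f_L1: "integrable (completion \<mu>) f"
    and f_supp: "AE x in completion \<mu>. x \<notin> \<Omega> \<longrightarrow> f x = 0"
  \<comment> \<open>Condition (A)\<close>
    and A_meas: "A \<in> borel_measurable (completion \<mu>)"
    and A_bdd: "\<exists>C. AE x in completion \<mu>. norm (A x) \<le> C"
    and lam: "lam > 0"
    and A_ell: "AE x in completion \<mu>. transpose (A x) = A x \<and> (\<forall>\<xi>. \<xi> \<bullet> (A x *v \<xi>) \<ge> 0) \<and>
                   (\<forall>\<xi>\<in>Tmu \<mu> x. \<xi> \<bullet> (A x *v \<xi>) \<ge> lam * (norm \<xi>)\<^sup>2)"
  \<comment> \<open>u is a minimizer of E_mu over H^{1,2}_mu, with g = grad_mu u\<close>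
    and u_H: "(u, g) \<in> H12 \<mu>"
    and u_min: "\<And>v h. (v, h) \<in> H12 \<mu> \<Longrightarrow> energy \<mu> \<Omega> A f (u, g) \<le> energy \<mu> \<Omega> A f (v, h)"
  shows "set_integrable (completion \<mu>) \<Omega> (\<lambda>x. A_mu \<mu> A x (g x))
    \<and> (\<forall>\<psi>\<in>C1c \<Omega>. (\<integral>x\<in>\<Omega>. A_mu \<mu> A x (g x) \<bullet> grad \<psi> x \<partial>completion \<mu>)
                    = (\<integral>x\<in>\<Omega>. f x * \<psi> x \<partial>completion \<mu>))
    \<and> bdd_above {(\<integral>x\<in>\<Omega>. A_mu \<mu> A x (g x) \<bullet> grad \<psi> x \<partial>completion \<mu>) | \<psi>.
                   \<psi> \<in> C1c \<Omega> \<and> (\<forall>x. \<bar>\<psi> x\<bar> \<le> 1)}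
    \<and> (\<exists>Dp Dm :: (real^'n) measure.
         sets Dp = sets borel \<and> sets Dm = sets borel \<and> finite_measure Dp \<and> finite_measure Dm \<and>
         emeasure Dp (UNIV - \<Omega>) = 0 \<and> emeasure Dm (UNIV - \<Omega>) = 0 \<and>
         (\<forall>\<psi>\<in>C1c \<Omega>. (\<integral>x. \<psi> x \<partial>Dp) - (\<integral>x. \<psi> x \<partial>Dm)
                        = - (\<integral>x\<in>\<Omega>. A_mu \<mu> A x (g x) \<bullet> grad \<psi> x \<partial>completion \<mu>)) \<and>
         (\<forall>\<phi>. Ck 2 \<phi> \<longrightarrow>
              (\<integral>x. \<phi> x \<partial>Dp) - (\<integral>x. \<phi> x \<partial>Dm)
                + (\<integral>x\<in>\<Omega>. A_mu \<mu> A x (g x) \<bullet> grad \<phi> x \<partial>completion \<mu>) = 0))"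
proof -
  let ?M = "completion \<mu>" and ?F = "\<lambda>x. A_mu \<mu> A x (g x)"
  have sets: "sets \<mu> = sets borel"
    unfolding mu_def using sets.sigma_sets_eq[of borel] by (simp add: sets_measure_of_conv)
  have "finite_measure \<mu>"
    using finite_measure_sum_hausdorff_restr[OF mu_def] manif by blast
  then have fin: "finite_measure ?M"
    by (intro finite_measureI) (simp add: finite_measure.emeasure_finite)
  interpret M: finite_measure ?M by (rule fin)
  have id: "(\<lambda>x. x) \<in> borel_measurable ?M"
    by (intro measurable_completion measurable_ident_sets sets)
  have \<Omega>': "open \<Omega>" "bounded \<Omega>" using \<Omega> by (auto simp: smooth_bounded_domain_def)
  have \<Omega>M: "\<Omega> \<in> sets ?M"
    by (rule sets_completionI_sets) (unfold sets, rule borel_open[OF \<Omega>'(1)])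
  obtain C where C: "AE x in ?M. norm (A x) \<le> C" using A_bdd by blast
  have sym: "AE x in ?M. transpose (A x) = A x" using A_ell by eventually_elim blast
  have g: "g \<in> borel_measurable ?M" "integrable ?M (\<lambda>x. (norm (g x))\<^sup>2)"
    using u_H unfolding H12_def by blast+
  have F: "integrable ?M ?F"
    by (rule M.integrable_L2_imp_L1[OF A_mu_L2[OF id A_meas C g]])
  \<comment> \<open>The single identity behind every conclusion after integrability: it holds for
    all \<open>C\<^sup>1\<close> functions, whether or not they vanish near the boundary.\<close>
  have weak: "(\<integral>x\<in>\<Omega>. ?F x \<bullet> grad \<phi> x \<partial>?M) = (\<integral>x\<in>\<Omega>. f x * \<phi> x \<partial>?M)" if "Ck 1 \<phi>" for \<phi>
    using Euler_Lagrange_Cc_inf[OF fin id \<Omega>M f_meas f_L2 A_meas C sym u_H u_min] that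
    by (rule weak_equation_extends_to_C1[OF \<Omega>M \<Omega>'(2) id F f_L1])
  have C1: "Ck 1 \<psi>" if "\<psi> \<in> C1c \<Omega>" for \<psi> using that by (simp add: C1c_def)
  obtain Dp Dm :: "(real^'n) measure" where D: "sets Dp = sets borel" "sets Dm = sets borel"
    "finite_measure Dp" "finite_measure Dm" "emeasure Dp (UNIV - \<Omega>) = 0" "emeasure Dm (UNIV - \<Omega>) = 0"
    "\<And>\<phi>. continuous_on UNIV \<phi> \<Longrightarrow> (\<integral>x. \<phi> x \<partial>Dp) - (\<integral>x. \<phi> x \<partial>Dm) = - (\<integral>x\<in>\<Omega>. f x * \<phi> x \<partial>?M)"
    by (rule signed_density[OF sets \<Omega>' f_L1]) (rule that)
  have div: "(\<integral>x. \<phi> x \<partial>Dp) - (\<integral>x. \<phi> x \<partial>Dm) = - (\<integral>x\<in>\<Omega>. ?F x \<bullet> grad \<phi> x \<partial>?M)" if "Ck 1 \<phi>" for \<phi>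
    unfolding weak[OF that] by (rule D(7)[OF Ck_continuous[OF that]])
  show ?thesis
  proof (intro conjI)
    show "set_integrable ?M \<Omega> ?F"
      unfolding set_integrable_def by (rule integrable_mult_indicator[OF \<Omega>M F])
    show "\<forall>\<psi>\<in>C1c \<Omega>. (\<integral>x\<in>\<Omega>. ?F x \<bullet> grad \<psi> x \<partial>?M) = (\<integral>x\<in>\<Omega>. f x * \<psi> x \<partial>?M)"
      using weak C1 by blast
    show "bdd_above {(\<integral>x\<in>\<Omega>. ?F x \<bullet> grad \<psi> x \<partial>?M) | \<psi>. \<psi> \<in> C1c \<Omega> \<and> (\<forall>x. \<bar>\<psi> x\<bar> \<le> 1)}"
    proof (rule bdd_aboveI)
      fix r assume "r \<in> {(\<integral>x\<in>\<Omega>. ?F x \<bullet> grad \<psi> x \<partial>?M) | \<psi>. \<psi> \<in> C1c \<Omega> \<and> (\<forall>x. \<bar>\<psi> x\<bar> \<le> 1)}"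
      then obtain \<psi> where \<psi>: "r = (\<integral>x\<in>\<Omega>. ?F x \<bullet> grad \<psi> x \<partial>?M)" "Ck 1 \<psi>" "\<And>x. \<bar>\<psi> x\<bar> \<le> 1"
        using C1 by blast
      \<comment> \<open>After \<open>weak\<close> no gradient is left, so the bound on
        \<open>\<psi>\<close> alone controls the variation by the \<open>L\<^sup>1\<close> norm of
        \<open>f\<close> on \<open>\<Omega>\<close>.\<close>
      have "\<bar>\<integral>x\<in>\<Omega>. f x \<bullet> \<psi> x \<partial>?M\<bar> \<le> 1 * (\<integral>x\<in>\<Omega>. norm (f x) \<partial>?M)"
        by (rule set_integrable_inner_bounded(2)[OF \<Omega>M f_L1 borel_measurable_compose_id[OF id Ck_continuous[OF \<psi>(2)]]])
          (simp add: \<psi>(3))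
      then show "r \<le> (\<integral>x\<in>\<Omega>. norm (f x) \<partial>?M)"
        unfolding \<psi>(1) weak[OF \<psi>(2)] by simp
    qed
    have "(\<integral>x. \<phi> x \<partial>Dp) - (\<integral>x. \<phi> x \<partial>Dm) + (\<integral>x\<in>\<Omega>. ?F x \<bullet> grad \<phi> x \<partial>?M) = 0" if "Ck 2 \<phi>" for \<phi>
    proof -
      have "Ck 1 \<phi>" using that Ck_Suc_imp_Ck[of 1 \<phi>] by (simp add: numeral_2_eq_2)
      then show ?thesis using div by simp
    qed
    then show "\<exists>Dp Dm :: (real^'n) measure.
         sets Dp = sets borel \<and> sets Dm = sets borel \<and> finite_measure Dp \<and> finite_measure Dm \<and>
         emeasure Dp (UNIV - \<Omega>) = 0 \<and> emeasure Dm (UNIV - \<Omega>) = 0 \<and>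
         (\<forall>\<psi>\<in>C1c \<Omega>. (\<integral>x. \<psi> x \<partial>Dp) - (\<integral>x. \<psi> x \<partial>Dm) = - (\<integral>x\<in>\<Omega>. ?F x \<bullet> grad \<psi> x \<partial>?M)) \<and>
         (\<forall>\<phi>. Ck 2 \<phi> \<longrightarrow>
              (\<integral>x. \<phi> x \<partial>Dp) - (\<integral>x. \<phi> x \<partial>Dm) + (\<integral>x\<in>\<Omega>. ?F x \<bullet> grad \<phi> x \<partial>?M) = 0)"
      using D(1-6) div C1 by (intro exI[of _ Dp] exI[of _ Dm]) simp
  qed
qed

end
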